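(* Let $M\xleftarrow{\ \pi\ }P\xrightarrow{\ \pi'\ }M'$ be a $\star$-diagram with structure group a compact Lie group $G$ and with $M,P,M'$ closed and connected. Let $\mathsf g_P$ be a $G\times G$-invariant Riemannian metric on $P$, and let $\mathsf g_M$, $\mathsf g_{M'}$ be the induced $G$-invariant metrics on $M$ and $M'$ (those for which $\pi$ and $\pi'$ are Riemannian submersions). Assume that the metric spaces $M/G$ and $M'/G$ are isometric and that the orbits of the $\bullet$-action and the orbits of the $\star$-action on $P$ are totally geodesic in $(P,\mathsf g_P)$. Let $\Phi$ be the collection of $G$-invariant eigenfunctions of $-\Delta_{\mathsf g_M}$ on $(M,\mathsf g_M)$. Then for each $\phi\in\Phi$, with $-\Delta_{\mathsf g_M}\phi=\lambda\phi$, the corresponding $G$-invariant function on $M'$ (again denoted $\phi$) satisfies $-\Delta_{\mathsf g_{M'}}\phi=\lambda'\phi$ with $\lambda'=\lambda$. Moreover, the roles of $(M,\mathsf g_M)$ and $(M',\mathsf g_{M'})$ can be interchanged: every $G$-invariant eigenfunction of $-\Delta_{\mathsf g_{M'}}$ on $M'$ corresponds to a $G$-invariant eigenfunction of $-\Delta_{\mathsf g_M}$ on $M$ with the same eigenvalue.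
   Context: **$\star$-diagram.** Let $G$ be a compact Lie group. A $\star$-diagram $M\leftarrow P\rightarrow M'$ with structure group $G$ consists of a smooth manifold $P$ with two free, smooth, mutually commuting $G$-actions, denoted $\bullet$ and $\star$, together with the quotient maps $\pi:P\to M=P/(G,\bullet)$ and $\pi':P\to M'=P/(G,\star)$, which are principal $G$-bundles. The two actions define a $G\times G$-action on $P$; the $\star$-action descends to a $G$-action on $M$ and the $\bullet$-action descends to a $G$-action on $M'$, and "$G$-invariant" on $M$ and $M'$ refers to these actions. **Identification of invariant functions.** Pull-back by $\pi$ and $\pi'$ gives ring isomorphisms $C^\infty_G(M)\cong C^\infty_{G\times G}(P)\cong C^\infty_G(M')$; a $G$-invariant $\phi$ on $M$ and a $G$-invariant $\phi'$ on $M'$ correspond to each other when $\phi\circ\pi=\phi'\circ\pi'$. **Laplacian.** $\Delta_{\mathsf g}=\mathrm{div}_{\mathsf g}\nabla$. *)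

theory Defs
  imports "HOL-Analysis.Analysis" "HOL-Algebra.Group_Action"
begin

section \<open>Smoothness in the model space\<close>

primrec Ck_on :: "nat \<Rightarrow> 'a::real_normed_vector set \<Rightarrow> ('a \<Rightarrow> 'b::real_normed_vector) \<Rightarrow> bool" where
  "Ck_on 0 U f \<longleftrightarrow> continuous_on U f"
| "Ck_on (Suc k) U f \<longleftrightarrow>
     (\<forall>x\<in>U. f differentiable (at x)) \<and> (\<forall>v. Ck_on k U (\<lambda>x. frechet_derivative f (at x) v))"

text \<open>Only meaningful for open \<open>U\<close>.\<close>
definition smooth_on :: "'a::real_normed_vector set \<Rightarrow> ('a \<Rightarrow> 'b::real_normed_vector) \<Rightarrow> bool" where
  "smooth_on U f \<longleftrightarrow> (\<forall>k. Ck_on k U f)"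

section \<open>Manifolds and smooth maps\<close>

text \<open>A chart is a pair (domain, coordinate map).  The model space is a finite-dimensional real
  inner product space; \<open>euclidean_space\<close> is not used because it excludes dimension \<open>0\<close>, whereas
  finite groups and one-point quotients have to be allowed.  The instance \<open>unit\<close> below
  is a model space of dimension \<open>0\<close>.\<close>

instantiation unit :: real_inner
begin
definition plus_unit :: "unit \<Rightarrow> unit \<Rightarrow> unit" where "plus_unit x y = ()"
definition zero_unit :: unit where "zero_unit = ()"
definition scaleR_unit :: "real \<Rightarrow> unit \<Rightarrow> unit" where "scaleR_unit r x = ()"
definition inner_unit :: "unit \<Rightarrow> unit \<Rightarrow> real" where "inner_unit x y = 0"
definition norm_unit :: "unit \<Rightarrow> real" where "norm_unit x = 0"
definition dist_unit :: "unit \<Rightarrow> unit \<Rightarrow> real" where "dist_unit x y = 0"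
definition sgn_unit :: "unit \<Rightarrow> unit" where "sgn_unit x = ()"
definition uniformity_unit :: "(unit \<times> unit) filter" where
  "uniformity_unit = (INF e\<in>{0<..}. principal {(x, y). dist x y < e})"
definition open_unit :: "unit set \<Rightarrow> bool" where
  "open_unit U \<longleftrightarrow> (\<forall>x\<in>U. eventually (\<lambda>(x', y). x' = x \<longrightarrow> y \<in> U) uniformity)"
instance
  by standard
    (auto simp: inner_unit_def norm_unit_def dist_unit_def uniformity_unit_def open_unit_def)
end

lemma finite_dimensional_unit: "\<exists>B::unit set. finite B \<and> span B = UNIV"
  by (rule exI[of _ UNIV]) (use span_superset[of "UNIV::unit set"] in auto)

type_synonym ('m, 'e) chart = "'m set \<times> ('m \<Rightarrow> 'e)"

abbreviation chart_inv :: "('m, 'e) chart \<Rightarrow> 'e \<Rightarrow> 'm" where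
  "chart_inv c \<equiv> inv_into (fst c) (snd c)"

definition is_chart :: "('m::topological_space, 'e::topological_space) chart \<Rightarrow> bool" where
  "is_chart c \<longleftrightarrow> open (fst c) \<and> open (snd c ` fst c) \<and>
     homeomorphism (fst c) (snd c ` fst c) (snd c) (chart_inv c)"

definition smooth_atlas :: "('m::topological_space, 'e::real_inner) chart set \<Rightarrow> bool" where
  "smooth_atlas A \<longleftrightarrow>
     (\<exists>B::'e set. finite B \<and> span B = UNIV) \<and>
     (\<forall>c\<in>A. is_chart c) \<and> (\<Union>c\<in>A. fst c) = UNIV \<and>
     (\<forall>c\<in>A. \<forall>d\<in>A. smooth_on (snd c ` (fst c \<inter> fst d)) (snd d \<circ> chart_inv c))"

definition chart_at :: "('m, 'e) chart set \<Rightarrow> 'm \<Rightarrow> ('m, 'e) chart" where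
  "chart_at A p = (SOME c. c \<in> A \<and> p \<in> fst c)"

definition prod_atlas ::
    "('m, 'e) chart set \<Rightarrow> ('n, 'f) chart set \<Rightarrow> ('m \<times> 'n, 'e \<times> 'f) chart set" where
  "prod_atlas A B = {(fst c \<times> fst d, map_prod (snd c) (snd d)) | c d. c \<in> A \<and> d \<in> B}"

definition line_atlas :: "(real, real) chart set" where
  "line_atlas = {(UNIV, id)}"

text \<open>Only meaningful for open \<open>W\<close>.\<close>
definition smooth_map_on :: "'m::topological_space set \<Rightarrow> ('m, 'e::real_normed_vector) chart set \<Rightarrow>
    ('n::topological_space, 'f::real_normed_vector) chart set \<Rightarrow> ('m \<Rightarrow> 'n) \<Rightarrow> bool" where
  "smooth_map_on W A B F \<longleftrightarrow> continuous_on W F \<and>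
     (\<forall>c\<in>A. \<forall>d\<in>B. smooth_on (snd c ` (fst c \<inter> W \<inter> F -` fst d)) (snd d \<circ> F \<circ> chart_inv c))"

abbreviation smooth_map :: "('m::topological_space, 'e::real_normed_vector) chart set \<Rightarrow>
    ('n::topological_space, 'f::real_normed_vector) chart set \<Rightarrow> ('m \<Rightarrow> 'n) \<Rightarrow> bool" where
  "smooth_map \<equiv> smooth_map_on UNIV"

abbreviation smooth_fun ::
    "('m::topological_space, 'e::real_normed_vector) chart set \<Rightarrow> ('m \<Rightarrow> real) \<Rightarrow> bool" where
  "smooth_fun A \<equiv> smooth_map A line_atlas"

text \<open>A tangent vector at \<open>p\<close> is handled through its components \<open>v\<close> in a chart around \<open>p\<close>.
  This is the differential at \<open>p\<close> of \<open>F\<close> in the charts \<open>c\<close> (around \<open>p\<close>) and \<open>d\<close> (around \<open>F p\<close>);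
  for \<open>F = id\<close> it is the change of components.\<close>
definition tangent_map :: "('m, 'e::real_normed_vector) chart \<Rightarrow>
    ('n, 'f::real_normed_vector) chart \<Rightarrow> ('m \<Rightarrow> 'n) \<Rightarrow> 'm \<Rightarrow> 'e \<Rightarrow> 'f" where
  "tangent_map c d F p v = frechet_derivative (snd d \<circ> F \<circ> chart_inv c) (at (snd c p)) v"

section \<open>Riemannian metrics\<close>

text \<open>\<open>g c p v w\<close> is the inner product of the tangent vectors at \<open>p\<close> with components \<open>v\<close>, \<open>w\<close>
  in the chart \<open>c\<close>.\<close>
type_synonym ('m, 'e) metric = "('m, 'e) chart \<Rightarrow> 'm \<Rightarrow> 'e \<Rightarrow> 'e \<Rightarrow> real"

definition local_metric :: "('m, 'e) metric \<Rightarrow> ('m, 'e) chart \<Rightarrow> 'e \<Rightarrow> 'e \<Rightarrow> 'e \<Rightarrow> real" where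
  "local_metric g c x = g c (chart_inv c x)"

definition riemannian_metric ::
    "('m, 'e::real_inner) chart set \<Rightarrow> ('m, 'e) metric \<Rightarrow> bool" where
  "riemannian_metric A g \<longleftrightarrow>
     (\<forall>c\<in>A.
        (\<forall>p\<in>fst c. bilinear (g c p) \<and> (\<forall>v w. g c p v w = g c p w v) \<and>
           (\<forall>v. v \<noteq> 0 \<longrightarrow> g c p v v > 0)) \<and>
        (\<forall>v w. smooth_on (snd c ` fst c) (\<lambda>x. local_metric g c x v w))) \<and>
     (\<forall>c\<in>A. \<forall>d\<in>A. \<forall>p\<in>fst c \<inter> fst d. \<forall>v w.
        g d p (tangent_map c d id p v) (tangent_map c d id p w) = g c p v w)"

definition preserves_metric ::
    "('m, 'e::real_inner) chart set \<Rightarrow> ('m, 'e) metric \<Rightarrow> ('m \<Rightarrow> 'm) \<Rightarrow> bool" where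
  "preserves_metric A g F \<longleftrightarrow>
     (\<forall>c\<in>A. \<forall>d\<in>A. \<forall>p\<in>fst c. F p \<in> fst d \<longrightarrow>
        (\<forall>v w. g d (F p) (tangent_map c d F p v) (tangent_map c d F p w) = g c p v w))"

definition horizontal :: "('m, 'e::real_inner) metric \<Rightarrow> ('m, 'e) chart \<Rightarrow>
    ('n, 'f::real_inner) chart \<Rightarrow> ('m \<Rightarrow> 'n) \<Rightarrow> 'm \<Rightarrow> 'e \<Rightarrow> bool" where
  "horizontal g c d F p v \<longleftrightarrow> (\<forall>z. tangent_map c d F p z = 0 \<longrightarrow> g c p v z = 0)"

definition riemannian_submersion ::
    "('m::topological_space, 'e::real_inner) chart set \<Rightarrow> ('m, 'e) metric \<Rightarrow>
     ('n::topological_space, 'f::real_inner) chart set \<Rightarrow> ('n, 'f) metric \<Rightarrow> ('m \<Rightarrow> 'n) \<Rightarrow> bool" where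
  "riemannian_submersion A g B k F \<longleftrightarrow> smooth_map A B F \<and>
     (\<forall>c\<in>A. \<forall>d\<in>B. \<forall>p\<in>fst c. F p \<in> fst d \<longrightarrow>
        surj (tangent_map c d F p) \<and>
        (\<forall>v w. horizontal g c d F p v \<and> horizontal g c d F p w \<longrightarrow>
           k d (F p) (tangent_map c d F p v) (tangent_map c d F p w) = g c p v w))"

section \<open>Levi-Civita connection and Laplacian\<close>

text \<open>In the following, \<open>h\<close> is a metric on an open subset of the model space.
  Koszul's formula for constant vector fields gives the Christoffel symbols
  \<open>christoffel h x v w = \<Gamma>(v, w)\<close>, where \<open>\<Gamma>(v, w)\<^sup>k = \<Gamma>\<^sup>k\<^sub>i\<^sub>j v\<^sup>i w\<^sup>j\<close>.\<close>
definition christoffel ::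
    "('e::real_inner \<Rightarrow> 'e \<Rightarrow> 'e \<Rightarrow> real) \<Rightarrow> 'e \<Rightarrow> 'e \<Rightarrow> 'e \<Rightarrow> 'e" where
  "christoffel h x v w = (THE u. \<forall>z.
     2 * h x u z = frechet_derivative (\<lambda>y. h y w z) (at x) v
                 + frechet_derivative (\<lambda>y. h y v z) (at x) w
                 - frechet_derivative (\<lambda>y. h y v w) (at x) z)"

text \<open>The covariant derivative of the vector field \<open>X\<close> at \<open>x\<close> in the direction \<open>v\<close>.\<close>
definition covariant_derivative ::
    "('e::real_inner \<Rightarrow> 'e \<Rightarrow> 'e \<Rightarrow> real) \<Rightarrow> 'e \<Rightarrow> ('e \<Rightarrow> 'e) \<Rightarrow> 'e \<Rightarrow> 'e" where
  "covariant_derivative h v X x = frechet_derivative X (at x) v + christoffel h x v (X x)"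

definition endo_trace :: "('e::real_inner \<Rightarrow> 'e) \<Rightarrow> real" where
  "endo_trace L = (let B = (SOME B. finite B \<and> pairwise orthogonal B \<and>
       (\<forall>b\<in>B. norm b = 1) \<and> span B = UNIV) in \<Sum>b\<in>B. inner (L b) b)"

definition divergence ::
    "('e::real_inner \<Rightarrow> 'e \<Rightarrow> 'e \<Rightarrow> real) \<Rightarrow> ('e \<Rightarrow> 'e) \<Rightarrow> 'e \<Rightarrow> real" where
  "divergence h X x = endo_trace (\<lambda>v. covariant_derivative h v X x)"

definition gradient ::
    "('e::real_inner \<Rightarrow> 'e \<Rightarrow> 'e \<Rightarrow> real) \<Rightarrow> ('e \<Rightarrow> real) \<Rightarrow> 'e \<Rightarrow> 'e" where
  "gradient h f x = (THE u. \<forall>v. h x u v = frechet_derivative f (at x) v)"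

text \<open>The value does not depend on the chart used.\<close>
definition laplacian ::
    "('m, 'e::real_inner) chart set \<Rightarrow> ('m, 'e) metric \<Rightarrow> ('m \<Rightarrow> real) \<Rightarrow> 'm \<Rightarrow> real" where
  "laplacian A g f p = (let c = chart_at A p; h = local_metric g c in
     divergence h (gradient h (f \<circ> chart_inv c)) (snd c p))"

definition eigenfunction :: "('m::topological_space, 'e::real_inner) chart set \<Rightarrow>
    ('m, 'e) metric \<Rightarrow> real \<Rightarrow> ('m \<Rightarrow> real) \<Rightarrow> bool" where
  "eigenfunction A g l f \<longleftrightarrow>
     smooth_fun A f \<and> (\<exists>p. f p \<noteq> 0) \<and> (\<forall>p. - laplacian A g f p = l * f p)"

section \<open>Totally geodesic submanifolds\<close>

text \<open>\<open>v\<close> (in the chart \<open>c\<close>) is the velocity at \<open>p\<close> of a smooth curve lying in the submanifold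
  \<open>S\<close>.\<close>
definition tangent_to :: "('m::topological_space, 'e::real_inner) chart set \<Rightarrow> 'm set \<Rightarrow>
    ('m, 'e) chart \<Rightarrow> 'm \<Rightarrow> 'e \<Rightarrow> bool" where
  "tangent_to A S c p v \<longleftrightarrow>
     (\<exists>s e. 0 < e \<and> smooth_map_on {-e<..<e} line_atlas A s \<and> s ` {-e<..<e} \<subseteq> S \<and> s 0 = p \<and>
        vector_derivative (snd c \<circ> s) (at 0) = v)"

text \<open>Vanishing second fundamental form: if the local vector fields \<open>X\<close> and \<open>Y\<close> are tangent to
  \<open>S\<close> along \<open>S\<close>, then so is the covariant derivative of \<open>Y\<close> along \<open>X\<close>.\<close>
definition totally_geodesic :: "('m::topological_space, 'e::real_inner) chart set \<Rightarrow>
    ('m, 'e) metric \<Rightarrow> 'm set \<Rightarrow> bool" where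
  "totally_geodesic A g S \<longleftrightarrow>
     (\<forall>c\<in>A. \<forall>W X Y. open W \<and> W \<subseteq> snd c ` fst c \<and> smooth_on W X \<and> smooth_on W Y \<and>
        (\<forall>p\<in>S \<inter> fst c. snd c p \<in> W \<longrightarrow>
           tangent_to A S c p (X (snd c p)) \<and> tangent_to A S c p (Y (snd c p))) \<longrightarrow>
        (\<forall>p\<in>S \<inter> fst c. snd c p \<in> W \<longrightarrow>
           tangent_to A S c p
             (covariant_derivative (local_metric g c) (X (snd c p)) Y (snd c p))))"

section \<open>Riemannian distance and orbit spaces\<close>

definition piecewise_smooth_path ::
    "('m::topological_space, 'e::real_inner) chart set \<Rightarrow> (real \<Rightarrow> 'm) \<Rightarrow> bool" where
  "piecewise_smooth_path A \<gamma> \<longleftrightarrow>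
     (\<exists>S. finite S \<and> {0, 1} \<subseteq> S \<and> S \<subseteq> {0..1} \<and>
        (\<forall>a\<in>S. \<forall>b\<in>S. a < b \<and> S \<inter> {a<..<b} = {} \<longrightarrow>
           (\<exists>s. smooth_map line_atlas A s \<and> (\<forall>t\<in>{a..b}. s t = \<gamma> t))))"

definition path_length ::
    "('m, 'e::real_inner) chart set \<Rightarrow> ('m, 'e) metric \<Rightarrow> (real \<Rightarrow> 'm) \<Rightarrow> real" where
  "path_length A g \<gamma> = integral {0..1} (\<lambda>t.
     let c = chart_at A (\<gamma> t); v = vector_derivative (snd c \<circ> \<gamma>) (at t)
     in sqrt (g c (\<gamma> t) v v))"

definition riemannian_dist :: "('m::topological_space, 'e::real_inner) chart set \<Rightarrow>
    ('m, 'e) metric \<Rightarrow> 'm \<Rightarrow> 'm \<Rightarrow> real" where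
  "riemannian_dist A g x y =
     Inf {path_length A g \<gamma> | \<gamma>. piecewise_smooth_path A \<gamma> \<and> \<gamma> 0 = x \<and> \<gamma> 1 = y}"

definition orbit_dist :: "('m::topological_space, 'e::real_inner) chart set \<Rightarrow>
    ('m, 'e) metric \<Rightarrow> 'm set \<Rightarrow> 'm set \<Rightarrow> real" where
  "orbit_dist A g X Y = Inf {riemannian_dist A g x y | x y. x \<in> X \<and> y \<in> Y}"

definition isometric_orbit_spaces :: "'g monoid \<Rightarrow>
    ('m::topological_space, 'e::real_inner) chart set \<Rightarrow> ('m, 'e) metric \<Rightarrow> ('g \<Rightarrow> 'm \<Rightarrow> 'm) \<Rightarrow>
    ('n::topological_space, 'f::real_inner) chart set \<Rightarrow> ('n, 'f) metric \<Rightarrow> ('g \<Rightarrow> 'n \<Rightarrow> 'n) \<Rightarrow>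
    bool" where
  "isometric_orbit_spaces G A g act B k act' \<longleftrightarrow>
     (\<exists>F. bij_betw F (orbits G UNIV act) (orbits G UNIV act') \<and>
        (\<forall>X\<in>orbits G UNIV act. \<forall>Y\<in>orbits G UNIV act.
           orbit_dist B k (F X) (F Y) = orbit_dist A g X Y))"

section \<open>Lie groups, principal bundles and star diagrams\<close>

definition compact_lie_group ::
    "'g::topological_space monoid \<Rightarrow> ('g, 'l::real_inner) chart set \<Rightarrow> bool" where
  "compact_lie_group G AG \<longleftrightarrow>
     group G \<and> carrier G = UNIV \<and> smooth_atlas AG \<and> compact (UNIV :: 'g set) \<and>
     smooth_map (prod_atlas AG AG) AG (\<lambda>(a, b). a \<otimes>\<^bsub>G\<^esub> b) \<and>
     smooth_map AG AG (\<lambda>a. inv\<^bsub>G\<^esub> a)"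

definition smooth_free_action :: "'g::topological_space monoid \<Rightarrow> ('g, 'l::real_inner) chart set \<Rightarrow>
    ('p::topological_space, 'e::real_inner) chart set \<Rightarrow> ('g \<Rightarrow> 'p \<Rightarrow> 'p) \<Rightarrow> bool" where
  "smooth_free_action G AG AP act \<longleftrightarrow>
     group_action G UNIV act \<and> smooth_map (prod_atlas AG AP) AP (\<lambda>(a, p). act a p) \<and>
     (\<forall>a p. act a p = p \<longrightarrow> a = \<one>\<^bsub>G\<^esub>)"

definition local_trivialization :: "'g::topological_space monoid \<Rightarrow> ('g, 'l::real_inner) chart set \<Rightarrow>
    ('p::topological_space, 'e::real_inner) chart set \<Rightarrow>
    ('m::topological_space, 'f::real_inner) chart set \<Rightarrow>
    ('g \<Rightarrow> 'p \<Rightarrow> 'p) \<Rightarrow> ('p \<Rightarrow> 'm) \<Rightarrow> 'm set \<Rightarrow> ('p \<Rightarrow> 'm \<times> 'g) \<Rightarrow> bool" where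
  "local_trivialization G AG AP AM act \<pi> U \<Phi> \<longleftrightarrow>
     open U \<and> bij_betw \<Phi> (\<pi> -` U) (U \<times> UNIV) \<and>
     smooth_map_on (\<pi> -` U) AP (prod_atlas AM AG) \<Phi> \<and>
     smooth_map_on (U \<times> UNIV) (prod_atlas AM AG) AP (inv_into (\<pi> -` U) \<Phi>) \<and>
     (\<forall>p\<in>\<pi> -` U. fst (\<Phi> p) = \<pi> p \<and> (\<forall>a. \<Phi> (act a p) = (\<pi> p, a \<otimes>\<^bsub>G\<^esub> snd (\<Phi> p))))"

text \<open>\<open>\<pi>\<close> is the quotient map of the action and a principal bundle.\<close>
definition principal_bundle :: "'g::topological_space monoid \<Rightarrow> ('g, 'l::real_inner) chart set \<Rightarrow>
    ('p::topological_space, 'e::real_inner) chart set \<Rightarrow>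
    ('m::topological_space, 'f::real_inner) chart set \<Rightarrow>
    ('g \<Rightarrow> 'p \<Rightarrow> 'p) \<Rightarrow> ('p \<Rightarrow> 'm) \<Rightarrow> bool" where
  "principal_bundle G AG AP AM act \<pi> \<longleftrightarrow>
     smooth_map AP AM \<pi> \<and> surj \<pi> \<and>
     (\<forall>p q. \<pi> p = \<pi> q \<longleftrightarrow> q \<in> orbit G act p) \<and>
     (\<forall>x. \<exists>U \<Phi>. x \<in> U \<and> local_trivialization G AG AP AM act \<pi> U \<Phi>)"

definition star_diagram :: "'g::topological_space monoid \<Rightarrow> ('g, 'l::real_inner) chart set \<Rightarrow>
    ('p::topological_space, 'e::real_inner) chart set \<Rightarrow>
    ('m::topological_space, 'f::real_inner) chart set \<Rightarrow>
    ('n::topological_space, 'h::real_inner) chart set \<Rightarrow>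
    ('g \<Rightarrow> 'p \<Rightarrow> 'p) \<Rightarrow> ('g \<Rightarrow> 'p \<Rightarrow> 'p) \<Rightarrow> ('p \<Rightarrow> 'm) \<Rightarrow> ('p \<Rightarrow> 'n) \<Rightarrow> bool" where
  "star_diagram G AG AP AM AM' bul star \<pi> \<pi>' \<longleftrightarrow>
     compact_lie_group G AG \<and> smooth_atlas AP \<and> smooth_atlas AM \<and> smooth_atlas AM' \<and>
     smooth_free_action G AG AP bul \<and> smooth_free_action G AG AP star \<and>
     (\<forall>a b p. bul a (star b p) = star b (bul a p)) \<and>
     principal_bundle G AG AP AM bul \<pi> \<and> principal_bundle G AG AP AM' star \<pi>'"

text \<open>The action on the base of \<open>\<pi>\<close> with \<open>descended act \<pi> a (\<pi> p) = \<pi> (act a p)\<close>,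
  for an action \<open>act\<close> that maps fibres of \<open>\<pi>\<close> to fibres.\<close>
definition descended :: "('g \<Rightarrow> 'p \<Rightarrow> 'p) \<Rightarrow> ('p \<Rightarrow> 'm) \<Rightarrow> 'g \<Rightarrow> 'm \<Rightarrow> 'm" where
  "descended act \<pi> a x = \<pi> (act a (inv_into UNIV \<pi> x))"

definition invariant_functions :: "('m::topological_space, 'e::real_inner) chart set \<Rightarrow>
    ('g \<Rightarrow> 'm \<Rightarrow> 'm) \<Rightarrow> ('m \<Rightarrow> real) set" where
  "invariant_functions A act = {f. smooth_fun A f \<and> (\<forall>a x. f (act a x) = f x)}"

end

theory Submission
  imports Defs
begin

text \<open>The heart of the matter is that the Laplacian commutes with pull-back along a Riemannian
  submersion \<open>F\<close> with totally geodesic fibres; applied to \<open>\<pi>\<close> and \<open>\<pi>'\<close> it identifies both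
  Laplacians with the Laplacian of \<open>P\<close> on doubly invariant functions.  Let \<open>X\<close> be the gradient of
  \<open>u \<circ> F\<close> and \<open>Y\<close> that of \<open>u\<close>.  The trace defining \<open>div X\<close> is computed in a basis of horizontal
  lifts \<open>e\<close> of an orthonormal basis and of orthonormal vertical vectors \<open>z\<close>.  A vertical term
  equals \<open>- h (X, \<nabla>\<^sub>Z Z)\<close> for a vertical field \<open>Z\<close> extending \<open>z\<close>, and vanishes because \<open>\<nabla>\<^sub>Z Z\<close> is
  again vertical.  A horizontal term is \<open>h (DX e, e) + 1/2 D\<^sub>X h (e, e)\<close>, which turns into the
  corresponding term of \<open>div Y\<close> by differentiating \<open>DF X = Y \<circ> F\<close> and by a minimum argument for
  \<open>h (e, e) - k (DF e, DF e)\<close>.\<close>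

section \<open>Metrics depending on a parameter\<close>

text \<open>The trace sees only the diagonal terms h (\<nabla>_e X, e), which depend on e at the
  point x alone, so a basis of the tangent space at x suffices and no frame of lifts has to be
  differentiated. The two sides of a horizontal term differ by second derivatives of F:
  differentiating DF X = Y o F subtracts k (D^2 F (X, e), DF e), and half of the derivative of h (e,
  e) along X adds the same quantity with X and e exchanged. They cancel because mixed second
  derivatives commute, hence the proof of that symmetry below. Vertical terms need more than a
  point: \<open>totally_geodesic\<close> speaks of local fields tangent to an orbit, so z must first
  be extended to such a field. The model spaces may have dimension 0 and carry an inner product
  unrelated to h and k; therefore expansions run over finite sets adapted to the metric at hand, and
  the trace is first freed from the basis that defines it.\<close>

abbreviation D :: "('a::real_normed_vector \<Rightarrow> 'b::real_normed_vector) \<Rightarrow> 'a \<Rightarrow> 'a \<Rightarrow> 'b" where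
  "D f x \<equiv> frechet_derivative f (at x)"

lemma has_derivative_D: "f differentiable (at x) \<Longrightarrow> (f has_derivative D f x) (at x)"
  using frechet_derivative_works by blast

lemma D_eq: "(f has_derivative f') (at x) \<Longrightarrow> D f x = f'"
  using frechet_derivative_at by metis

lemma has_derivative_differentiable: "(f has_derivative f') F \<Longrightarrow> f differentiable F"
  by (auto simp: differentiable_def)

lemma differentiable_cong_open:
  assumes "f differentiable (at x)" "open U" "x \<in> U" "\<And>y. y \<in> U \<Longrightarrow> f y = g y"
  shows "g differentiable (at x)"
  using has_derivative_transform_within_open[OF has_derivative_D[OF assms(1)] assms(2-4)]
  by (rule has_derivative_differentiable)

lemma D_cong_open:
  assumes "f differentiable (at x)" "open U" "x \<in> U" "\<And>y. y \<in> U \<Longrightarrow> f y = g y"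
  shows "D f x = D g x"
  using D_eq[OF has_derivative_transform_within_open[OF has_derivative_D[OF assms(1)] assms(2-4)]] ..

section \<open>Orthonormal bases and traces\<close>

definition orthonormal_basis :: "'a::real_inner set \<Rightarrow> bool" where
  "orthonormal_basis B \<longleftrightarrow>
     finite B \<and> pairwise orthogonal B \<and> (\<forall>b\<in>B. norm b = 1) \<and> span B = UNIV"

lemma orthonormal_basis_finite: "orthonormal_basis B \<Longrightarrow> finite B"
  by (simp add: orthonormal_basis_def)

lemma orthonormal_basis_exists:
  assumes "\<exists>B::'a::real_inner set. finite B \<and> span B = UNIV"
  shows "\<exists>B::'a set. orthonormal_basis B"
proof -
  obtain B0 :: "'a set" where "finite B0" "span B0 = UNIV" using assms by auto
  then obtain C :: "'a set" where C: "finite C" "span C = UNIV" "pairwise orthogonal C"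
    using basis_orthogonal by metis
  \<comment> \<open>Gram-Schmidt may leave 0 in C; it is dropped before normalizing.\<close>
  let ?B = "(\<lambda>x. x /\<^sub>R norm x) ` (C - {0})"
  have "pairwise orthogonal ?B"
    using C(3) unfolding pairwise_def by (auto simp: orthogonal_def)
  moreover have "C \<subseteq> span ?B"
  proof
    fix x assume x: "x \<in> C"
    show "x \<in> span ?B"
    proof (cases "x = 0")
      case False
      then have "x = norm x *\<^sub>R (x /\<^sub>R norm x)" by simp
      moreover have "x /\<^sub>R norm x \<in> ?B" using False x by blast
      ultimately show ?thesis by (metis span_base span_scale)
    qed (simp add: span_zero)
  qed
  then have "span ?B = UNIV" using C(2) by (metis span_span span_mono top.extremum_uniqueI)
  ultimately have "orthonormal_basis ?B" using C(1) unfolding orthonormal_basis_def by auto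
  then show ?thesis by blast
qed

text \<open>The residual of the expansion is orthogonal to B, hence to its span, which contains the
  residual itself.\<close>

lemma orthonormal_basis_expand:
  assumes B: "orthonormal_basis B"
  shows "(\<Sum>b\<in>B. inner v b *\<^sub>R b) = v"
proof -
  let ?w = "v - (\<Sum>b\<in>B. inner v b *\<^sub>R b)"
  have fin: "finite B" and o: "\<And>a b. a \<in> B \<Longrightarrow> b \<in> B \<Longrightarrow> inner a b = (if a = b then 1 else 0)"
    using B unfolding orthonormal_basis_def pairwise_def orthogonal_def
    by (auto simp: norm_eq_1)
  have "inner ?w a = 0" if "a \<in> B" for a
  proof -
    have "inner ?w a = inner v a - (\<Sum>b\<in>B. inner v b * inner b a)"
      by (simp add: inner_diff_left inner_sum_left)
    also have "(\<Sum>b\<in>B. inner v b * inner b a) = (\<Sum>b\<in>B. if b = a then inner v b else 0)"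
      by (rule sum.cong) (use o that in auto)
    finally show ?thesis using fin that by simp
  qed
  then have "orthogonal ?w a" if "a \<in> span B" for a
    using orthogonal_to_span[OF that, of ?w] by (simp add: orthogonal_def)
  then have "orthogonal ?w ?w" using B by (simp add: orthonormal_basis_def)
  then show ?thesis by (simp add: orthogonal_self)
qed

lemma linear_expand:
  assumes "orthonormal_basis B" "linear L"
  shows "L v = (\<Sum>b\<in>B. inner v b *\<^sub>R L b)"
proof -
  have "L v = L (\<Sum>b\<in>B. inner v b *\<^sub>R b)" using orthonormal_basis_expand[OF assms(1), of v] by simp
  also have "\<dots> = (\<Sum>b\<in>B. inner v b *\<^sub>R L b)"
    using assms(2) by (simp add: linear_sum linear_scale)
  finally show ?thesis .
qed

text \<open>The trace may be computed from any finite resolution of the identity, so the e i can be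
  adapted to the metric h instead of the inner product of the model space. Expanding each b in the e
  i and exchanging the sums reassembles L (e i) inside \<phi> i.\<close>

lemma endo_trace_eq:
  fixes L :: "'a::real_inner \<Rightarrow> 'a"
  assumes L: "linear L" and fd: "\<exists>B::'a set. orthonormal_basis B" and "finite I"
    and \<phi>: "\<And>i. i \<in> I \<Longrightarrow> linear (\<phi> i)" and e: "\<And>v. v = (\<Sum>i\<in>I. \<phi> i v *\<^sub>R e i)"
  shows "endo_trace L = (\<Sum>i\<in>I. \<phi> i (L (e i)))"
proof -
  define B :: "'a set" where "B = (SOME B. orthonormal_basis B)"
  have B: "orthonormal_basis B" unfolding B_def using fd by (rule someI_ex)
  have "endo_trace L = (\<Sum>b\<in>B. inner (L b) b)"
    by (simp add: endo_trace_def Let_def B_def orthonormal_basis_def)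
  also have "\<dots> = (\<Sum>b\<in>B. \<Sum>i\<in>I. \<phi> i b * inner (L (e i)) b)"
  proof (rule sum.cong[OF refl])
    fix b
    have "L b = L (\<Sum>i\<in>I. \<phi> i b *\<^sub>R e i)" by (rule arg_cong[OF e])
    also have "\<dots> = (\<Sum>i\<in>I. \<phi> i b *\<^sub>R L (e i))" using L by (simp add: linear_sum linear_scale)
    finally show "inner (L b) b = (\<Sum>i\<in>I. \<phi> i b * inner (L (e i)) b)" by (simp add: inner_sum_left)
  qed
  also have "\<dots> = (\<Sum>i\<in>I. \<Sum>b\<in>B. \<phi> i b * inner (L (e i)) b)" by (rule sum.swap)
  also have "\<dots> = (\<Sum>i\<in>I. \<phi> i (L (e i)))"
  proof (intro sum.cong refl)
    fix i assume "i \<in> I"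
    show "(\<Sum>b\<in>B. \<phi> i b * inner (L (e i)) b) = \<phi> i (L (e i))"
      by (subst linear_expand[OF B \<phi>[OF \<open>i \<in> I\<close>], of "L (e i)"]) (simp add: mult.commute)
  qed
  finally show ?thesis .
qed

text \<open>Product rule for a moving linear map about which only the derivatives at fixed arguments
  w are known. Finite dimension makes this enough: in an orthonormal basis T y (X y) is a finite sum
  of scalar functions times the T y b.\<close>

lemma has_derivative_linear_apply:
  fixes T :: "'x::real_normed_vector \<Rightarrow> 'e::real_inner \<Rightarrow> 'b::real_normed_vector"
  assumes fd: "\<exists>B::'e set. orthonormal_basis B" and U: "open U" "x \<in> U"
    and lin: "\<And>y. y \<in> U \<Longrightarrow> linear (T y)"
    and T: "\<And>w. ((\<lambda>y. T y w) has_derivative T' w) (at x)"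
    and X: "(X has_derivative X') (at x)"
  shows "((\<lambda>y. T y (X y)) has_derivative (\<lambda>v. T' (X x) v + T x (X' v))) (at x)"
proof -
  obtain B :: "'e set" where B: "orthonormal_basis B" using fd by blast
  \<comment> \<open>T' inherits linearity in w from T, by uniqueness of derivatives.\<close>
  have T': "T' w v = (\<Sum>b\<in>B. inner w b *\<^sub>R T' b v)" for w v
  proof -
    have "((\<lambda>y. \<Sum>b\<in>B. inner w b *\<^sub>R T y b) has_derivative (\<lambda>v. \<Sum>b\<in>B. inner w b *\<^sub>R T' b v)) (at x)"
      by (intro has_derivative_sum has_derivative_scaleR_right T)
    then have "((\<lambda>y. T y w) has_derivative (\<lambda>v. \<Sum>b\<in>B. inner w b *\<^sub>R T' b v)) (at x)"
      by (rule has_derivative_transform_within_open[OF _ U]) (rule linear_expand[OF B lin, symmetric])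
    then show ?thesis using has_derivative_unique[OF T] by metis
  qed
  have "((\<lambda>y. \<Sum>b\<in>B. inner (X y) b *\<^sub>R T y b) has_derivative
      (\<lambda>v. \<Sum>b\<in>B. inner (X x) b *\<^sub>R T' b v + inner (X' v) b *\<^sub>R T x b)) (at x)"
    by (intro has_derivative_sum has_derivative_scaleR T has_derivative_inner_left X)
  also have "(\<lambda>v. \<Sum>b\<in>B. inner (X x) b *\<^sub>R T' b v + inner (X' v) b *\<^sub>R T x b) =
      (\<lambda>v. T' (X x) v + T x (X' v))"
  proof
    fix v
    show "(\<Sum>b\<in>B. inner (X x) b *\<^sub>R T' b v + inner (X' v) b *\<^sub>R T x b) = T' (X x) v + T x (X' v)"
      unfolding sum.distrib T'[of "X x" v, symmetric] linear_expand[OF B lin[OF U(2)], symmetric] ..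
  qed
  finally show ?thesis
    by (rule has_derivative_transform_within_open[OF _ U]) (rule linear_expand[OF B lin, symmetric])
qed

text \<open>Points and vectors have separate types because the metric of the base is also read along
  F, as a family indexed by points of the total space. One derivative in the point is what Koszul's
  formula consumes.\<close>

definition metric_on :: "'x::real_normed_vector set \<Rightarrow> ('x \<Rightarrow> 'e::real_inner \<Rightarrow> 'e \<Rightarrow> real) \<Rightarrow> bool" where
  "metric_on U h \<longleftrightarrow> open U \<and>
     (\<forall>x\<in>U. bilinear (h x) \<and> (\<forall>v w. h x v w = h x w v) \<and> (\<forall>v. v \<noteq> 0 \<longrightarrow> h x v v > 0)) \<and>
     (\<forall>x\<in>U. \<forall>v w. (\<lambda>y. h y v w) differentiable (at x))"

lemma metric_onD:
  assumes "metric_on U h"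
  shows "open U" and "x \<in> U \<Longrightarrow> bilinear (h x)" and "x \<in> U \<Longrightarrow> h x v w = h x w v"
    and "x \<in> U \<Longrightarrow> v \<noteq> 0 \<Longrightarrow> h x v v > 0"
    and "x \<in> U \<Longrightarrow> (\<lambda>y. h y v w) differentiable (at x)"
  using assms unfolding metric_on_def by simp_all

lemma D_metric_commute:
  assumes h: "metric_on U h" and x: "x \<in> U"
  shows "D (\<lambda>y. h y v w) x = D (\<lambda>y. h y w v) x"
  by (rule D_cong_open[OF metric_onD(5)[OF h x] metric_onD(1)[OF h] x], rule metric_onD(3)[OF h])

lemma metric_on_linear:
  assumes "metric_on U h" "x \<in> U"
  shows "linear (h x v)" and "linear (\<lambda>v. h x v w)"
  using metric_onD(2)[OF assms] unfolding bilinear_def by auto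

lemma metric_simps:
  assumes "metric_on U h" "x \<in> U"
  shows "h x (u + v) w = h x u w + h x v w" "h x w (u + v) = h x w u + h x w v"
    "h x (u - v) w = h x u w - h x v w" "h x w (u - v) = h x w u - h x w v"
    "h x (r *\<^sub>R v) w = r * h x v w" "h x w (r *\<^sub>R v) = r * h x w v"
    "h x (\<Sum>i\<in>I. f i) w = (\<Sum>i\<in>I. h x (f i) w)" "h x w (\<Sum>i\<in>I. f i) = (\<Sum>i\<in>I. h x w (f i))"
    "h x 0 w = 0" "h x w 0 = 0"
  using linear_add[OF metric_on_linear(2)[OF assms]] linear_add[OF metric_on_linear(1)[OF assms]]
    linear_diff[OF metric_on_linear(2)[OF assms]] linear_diff[OF metric_on_linear(1)[OF assms]]
    linear_scale[OF metric_on_linear(2)[OF assms]] linear_scale[OF metric_on_linear(1)[OF assms]]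
    linear_sum[OF metric_on_linear(2)[OF assms]] linear_sum[OF metric_on_linear(1)[OF assms]]
    linear_0[OF metric_on_linear(2)[OF assms]] linear_0[OF metric_on_linear(1)[OF assms]]
  by auto

text \<open>Leibniz rule with three factors. The derivative of h itself is taken with both vectors
  frozen at x, the form in which it occurs in Koszul's formula.\<close>

lemma has_derivative_metric:
  fixes h :: "'x::real_normed_vector \<Rightarrow> 'e::real_inner \<Rightarrow> 'e \<Rightarrow> real"
  assumes fd: "\<exists>B::'e set. orthonormal_basis B" and h: "metric_on U h" and x: "x \<in> U"
    and X: "(X has_derivative X') (at x)" and Y: "(Y has_derivative Y') (at x)"
  shows "((\<lambda>y. h y (X y) (Y y)) has_derivative
    (\<lambda>v. D (\<lambda>y. h y (X x) (Y x)) x v + h x (X' v) (Y x) + h x (X x) (Y' v))) (at x)"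
proof -
  have 1: "((\<lambda>y. h y (X y) w) has_derivative (\<lambda>v. D (\<lambda>y. h y (X x) w) x v + h x (X' v) w)) (at x)" for w
    by (rule has_derivative_linear_apply[OF fd metric_onD(1)[OF h] x metric_on_linear(2)[OF h]
          has_derivative_D X]) (use metric_onD(5)[OF h x] in auto)
  show ?thesis
    using has_derivative_linear_apply[OF fd metric_onD(1)[OF h] x metric_on_linear(1)[OF h] 1 Y]
    by simp
qed

lemma metric_differentiable:
  fixes h :: "'x::real_normed_vector \<Rightarrow> 'e::real_inner \<Rightarrow> 'e \<Rightarrow> real"
  assumes "\<exists>B::'e set. orthonormal_basis B" "metric_on U h" "x \<in> U"
    and "X differentiable (at x)" "Y differentiable (at x)"
  shows "(\<lambda>y. h y (X y) (Y y)) differentiable (at x)"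
  using has_derivative_metric[OF assms(1-3) has_derivative_D has_derivative_D] assms(4,5)
    has_derivative_differentiable by blast

text \<open>Gram-Schmidt run at all points of U at once: the new vector is \<open>a\<close> minus
  its projection c y, divided by its length N y. It stays differentiable because \<open>a\<close> is
  outside the span of S, so the radicand is positive everywhere.\<close>

lemma orthonormal_frame:
  fixes h :: "'x::real_normed_vector \<Rightarrow> 'e::real_inner \<Rightarrow> 'e \<Rightarrow> real" and S :: "'e set"
  assumes fd: "\<exists>B::'e set. orthonormal_basis B" and h: "metric_on U h"
    and "finite S" "independent S"
  shows "\<exists>e. \<forall>y\<in>U. \<forall>s\<in>S. e s differentiable (at y) \<and> e s y \<in> span S \<and>
      (\<forall>t\<in>S. h y (e s y) (e t y) = (if s = t then 1 else 0)) \<and>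
      (\<forall>v\<in>span S. v = (\<Sum>s\<in>S. h y v (e s y) *\<^sub>R e s y))"
  using assms(3,4)
proof (induction S)
  case (insert a S)
  have a: "a \<notin> span S" and ind: "independent S"
    using insert by (auto simp: independent_insert)
  obtain e where e: "\<And>y s. y \<in> U \<Longrightarrow> s \<in> S \<Longrightarrow> e s differentiable (at y)"
      "\<And>y s. y \<in> U \<Longrightarrow> s \<in> S \<Longrightarrow> e s y \<in> span S"
      "\<And>y s t. y \<in> U \<Longrightarrow> s \<in> S \<Longrightarrow> t \<in> S \<Longrightarrow> h y (e s y) (e t y) = (if s = t then 1 else 0)"
      "\<And>y s v. y \<in> U \<Longrightarrow> s \<in> S \<Longrightarrow> v \<in> span S \<Longrightarrow> v = (\<Sum>s\<in>S. h y v (e s y) *\<^sub>R e s y)"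
    using insert.IH[OF ind] by blast
  \<comment> \<open>The expansion in the induction hypothesis stands below the quantifier over s in
    S and says nothing when S is empty; that case is added here.\<close>
  have e4: "v = (\<Sum>s\<in>S. h y v (e s y) *\<^sub>R e s y)" if "y \<in> U" "v \<in> span S" for y v
    using e(4)[OF that(1) _ that(2)] that(2) by (cases "S = {}") auto
  define c where "c y = (\<Sum>s\<in>S. h y a (e s y) *\<^sub>R e s y)" for y
  define N where "N y = sqrt (h y (a - c y) (a - c y))" for y
  define n where "n y = (a - c y) /\<^sub>R N y" for y
  define e' where "e' s = (if s = a then n else e s)" for s
  have cspan: "c y \<in> span S" if "y \<in> U" for y
    unfolding c_def using e(2)[OF that] by (intro span_sum span_scale)
  have pos: "h y (a - c y) (a - c y) > 0" if "y \<in> U" for y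
  proof -
    have "a - c y \<noteq> 0" using a cspan[OF that] by auto
    then show ?thesis using metric_onD(4)[OF h that] by blast
  qed
  have Npos: "N y > 0" if "y \<in> U" for y
    using pos[OF that] by (simp add: N_def)
  have NN: "N y * N y = h y (a - c y) (a - c y)" if "y \<in> U" for y
    using pos[OF that] by (simp add: N_def)
  have orth: "h y (a - c y) (e s y) = 0" if "y \<in> U" "s \<in> S" for y s
  proof -
    have "h y (c y) (e s y) = (\<Sum>t\<in>S. h y a (e t y) * h y (e t y) (e s y))"
      unfolding c_def by (simp add: metric_simps[OF h that(1)])
    also have "\<dots> = (\<Sum>t\<in>S. if t = s then h y a (e t y) else 0)"
      by (rule sum.cong) (use e(3)[OF that(1) _ that(2)] in auto)
    also have "\<dots> = h y a (e s y)" using that insert.hyps(1) by simp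
    finally show ?thesis by (simp add: metric_simps[OF h that(1)])
  qed
  have north: "h y (n y) (e s y) = 0" if "y \<in> U" "s \<in> S" for y s
    using orth[OF that] by (simp add: n_def metric_simps[OF h that(1)])
  have orthv: "h y (a - c y) v = 0" if y: "y \<in> U" and v: "v \<in> span S" for y v
  proof -
    have "h y (a - c y) v = h y (a - c y) (\<Sum>s\<in>S. h y v (e s y) *\<^sub>R e s y)"
      by (rule arg_cong[OF e4[OF y v]])
    also have "\<dots> = (\<Sum>s\<in>S. h y v (e s y) * h y (a - c y) (e s y))"
      by (simp add: metric_simps[OF h y])
    also have "\<dots> = 0" using orth[OF y] by simp
    finally show ?thesis .
  qed
  have north2: "h y (e s y) (n y) = 0" if "y \<in> U" "s \<in> S" for y s
    using north[OF that] metric_onD(3)[OF h that(1)] by simp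
  have nn: "h y (n y) (n y) = 1" if "y \<in> U" for y
    using NN[OF that, symmetric] Npos[OF that]
    by (simp add: n_def metric_simps(5,6)[OF h that] flip: mult.assoc)
  have aS: "a \<notin> S" using insert by blast
  have e's: "e' s = e s" if "s \<in> S" for s using that aS by (auto simp: e'_def)
  have e'a: "e' a = n" by (simp add: e'_def)
  show ?case
  proof (intro exI[of _ e'] ballI conjI)
    fix y s assume y: "y \<in> U" and s: "s \<in> insert a S"
    have cd: "c differentiable (at y)" unfolding c_def
      by (intro differentiable_sum ballI differentiable_scaleR metric_differentiable[OF fd h y]
          e(1)[OF y] differentiable_const insert.hyps(1))
    have "(\<lambda>y. h y (a - c y) (a - c y)) differentiable (at y)"
      by (intro metric_differentiable[OF fd h y] differentiable_diff cd differentiable_const)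
    from has_derivative_real_sqrt[OF pos[OF y] has_derivative_D[OF this]]
    have "N differentiable (at y)" unfolding N_def
      by (rule has_derivative_differentiable)
    then have nd: "n differentiable (at y)" unfolding n_def using Npos[OF y]
      by (intro differentiable_scaleR differentiable_inverse differentiable_diff cd differentiable_const) auto
    show "e' s differentiable (at y)" using s nd e(1)[OF y] by (auto simp: e'_def)
    have "n y \<in> span (insert a S)" unfolding n_def
      using cspan[OF y] span_mono[of S "insert a S"]
      by (intro span_scale span_diff) (auto intro: span_base)
    then show "e' s y \<in> span (insert a S)"
      using s e(2)[OF y] span_mono[of S "insert a S"] by (auto simp: e'_def)
    show "h y (e' s y) (e' t y) = (if s = t then 1 else 0)" if "t \<in> insert a S" for t
      using s that nn[OF y] north[OF y] north2[OF y] e(3)[OF y] aS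
      by (auto simp: e's e'a)
    show "v = (\<Sum>s\<in>insert a S. h y v (e' s y) *\<^sub>R e' s y)" if v: "v \<in> span (insert a S)" for v
    proof -
      obtain k where k: "v - k *\<^sub>R a \<in> span S" using v by (auto simp: span_insert)
      \<comment> \<open>Replacing \<open>a\<close> by a - c y, which is N y times n y, splits v into
        a part in span S and the new coordinate k * N y.\<close>
      define w where "w = v - k *\<^sub>R (a - c y)"
      have w: "w \<in> span S"
      proof -
        have "w = (v - k *\<^sub>R a) + k *\<^sub>R c y" by (simp add: w_def algebra_simps)
        then show ?thesis using k cspan[OF y] by (metis span_add span_scale)
      qed
      have an: "a - c y = N y *\<^sub>R n y" using Npos[OF y] by (simp add: n_def)
      have veq: "v = w + (k * N y) *\<^sub>R n y" using an by (simp add: w_def)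
      have "h y w (n y) = 0"
        using orthv[OF y w] metric_onD(3)[OF h y, of w]
        by (simp add: n_def metric_simps(5,6)[OF h y])
      then have 1: "h y v (n y) = k * N y"
        using nn[OF y] by (simp add: veq metric_simps[OF h y])
      have 2: "h y v (e s y) = h y w (e s y)" if "s \<in> S" for s
        using north[OF y that] by (simp add: veq metric_simps[OF h y])
      have "(\<Sum>s\<in>insert a S. h y v (e' s y) *\<^sub>R e' s y) =
          (k * N y) *\<^sub>R n y + (\<Sum>s\<in>S. h y w (e s y) *\<^sub>R e s y)"
        using insert.hyps aS 1 2 by (simp add: e'a e's)
      then show ?thesis using e4[OF y w, symmetric] veq by simp
    qed
  qed
qed simp

lemma orthonormal_frame_UNIV:
  fixes h :: "'x::real_normed_vector \<Rightarrow> 'e::real_inner \<Rightarrow> 'e \<Rightarrow> real"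
  assumes fd: "\<exists>B::'e set. orthonormal_basis B" and h: "metric_on U h"
  obtains S :: "'e set" and e where "finite S"
    "\<And>y s. y \<in> U \<Longrightarrow> s \<in> S \<Longrightarrow> e s differentiable (at y)"
    "\<And>y s t. y \<in> U \<Longrightarrow> s \<in> S \<Longrightarrow> t \<in> S \<Longrightarrow> h y (e s y) (e t y) = (if s = t then 1 else 0)"
    "\<And>y v. y \<in> U \<Longrightarrow> v = (\<Sum>s\<in>S. h y v (e s y) *\<^sub>R e s y)"
proof -
  obtain B :: "'e set" where B: "orthonormal_basis B" using fd by blast
  obtain S where S: "independent S" "span S = span B" "S \<subseteq> B"
    by (metis maximal_independent_subset span_eq span_mono span_span)
  have fS: "finite S" using S(3) orthonormal_basis_finite[OF B] finite_subset by blast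
  have sp: "span S = UNIV" using S B by (simp add: orthonormal_basis_def)
  obtain e where e: "\<And>y s. y \<in> U \<Longrightarrow> s \<in> S \<Longrightarrow> e s differentiable (at y)"
      "\<And>y s t. y \<in> U \<Longrightarrow> s \<in> S \<Longrightarrow> t \<in> S \<Longrightarrow> h y (e s y) (e t y) = (if s = t then 1 else 0)"
      "\<And>y s v. y \<in> U \<Longrightarrow> s \<in> S \<Longrightarrow> v = (\<Sum>s\<in>S. h y v (e s y) *\<^sub>R e s y)"
    using orthonormal_frame[OF fd h fS S(1)] unfolding sp by blast
  have "v = (\<Sum>s\<in>S. h y v (e s y) *\<^sub>R e s y)" if "y \<in> U" for y v
  proof (cases "S = {}")
    case True
    then have "v \<in> span {}" using sp by auto
    then show ?thesis using True by simp
  qed (use e(3)[OF that] in blast)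
  then show ?thesis using that fS e by blast
qed

text \<open>A single inner product is a constant family of metrics; the frame provided for it is
  evaluated at one point, here 0. The subspace will be the vertical space, the kernel of DF.\<close>

lemma orthonormal_subspace_basis:
  fixes q :: "'e::real_inner \<Rightarrow> 'e \<Rightarrow> real"
  assumes fd: "\<exists>B::'e set. orthonormal_basis B"
    and q: "bilinear q" "\<And>v w. q v w = q w v" "\<And>v. v \<noteq> 0 \<Longrightarrow> q v v > 0"
    and K: "subspace K"
  obtains S where "finite S" "S \<subseteq> K" "\<And>s t. s \<in> S \<Longrightarrow> t \<in> S \<Longrightarrow> q s t = (if s = t then 1 else 0)"
    "\<And>v. v \<in> K \<Longrightarrow> v = (\<Sum>s\<in>S. q v s *\<^sub>R s)"
proof -
  obtain B :: "'e set" where B: "orthonormal_basis B" using fd by blast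
  obtain T where T: "T \<subseteq> K" "independent T" "K \<subseteq> span T"
    by (metis maximal_independent_subset)
  have spT: "span T = K" using T K by (simp add: span_minimal subset_antisym)
  have fT: "finite T"
    using independent_span_bound[of B T] B T(2) by (auto simp: orthonormal_basis_def)
  have "metric_on (UNIV::'e set) (\<lambda>_. q)"
    using q unfolding metric_on_def by (auto intro: differentiable_const)
  from orthonormal_frame[OF fd this fT T(2)] obtain e :: "'e \<Rightarrow> 'e \<Rightarrow> 'e" where
    e: "\<And>y s. s \<in> T \<Longrightarrow> e s y \<in> K"
      "\<And>y s t. s \<in> T \<Longrightarrow> t \<in> T \<Longrightarrow> q (e s y) (e t y) = (if s = t then 1 else 0)"
      "\<And>y s v. s \<in> T \<Longrightarrow> v \<in> K \<Longrightarrow> v = (\<Sum>s\<in>T. q v (e s y) *\<^sub>R e s y)"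
    unfolding spT by blast
  let ?f = "\<lambda>s. e s (0::'e)"
  have inj: "inj_on ?f T"
    by (rule inj_onI) (metis e(2) zero_neq_one)
  have expand: "v = (\<Sum>s\<in>?f ` T. q v s *\<^sub>R s)" if "v \<in> K" for v
  proof (cases "T = {}")
    case True
    then show ?thesis using that T(3) by auto
  next
    case False
    then show ?thesis using e(3)[OF _ that] sum.reindex[OF inj, of "\<lambda>s. q v s *\<^sub>R s"] by fastforce
  qed
  have orth: "q s t = (if s = t then 1 else 0)" if "s \<in> ?f ` T" "t \<in> ?f ` T" for s t
    using that e(2) inj by (auto simp: inj_on_eq_iff)
  have "?f ` T \<subseteq> K" using e(1) by blast
  from that[OF finite_imageI[OF fT] this orth expand] show ?thesis .
qed

section \<open>Riesz vectors, Christoffel symbols and gradients\<close>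

lemma metric_nondegenerate:
  assumes h: "metric_on U h" and x: "x \<in> U" and "\<And>z. h x u z = h x u' z"
  shows "u = u'"
proof -
  have "h x (u - u') (u - u') = 0" using assms(3) by (simp add: metric_simps(3)[OF h x])
  then show ?thesis using metric_onD(4)[OF h x, of "u - u'"] by force
qed

text \<open>This makes the definite descriptions in \<open>christoffel\<close> and
  \<open>gradient\<close> meaningful. The vector is the sum of the frame vectors weighted by the
  values of l on them.\<close>

lemma riesz:
  fixes h :: "'x::real_normed_vector \<Rightarrow> 'e::real_inner \<Rightarrow> 'e \<Rightarrow> real"
  assumes fd: "\<exists>B::'e set. orthonormal_basis B" and h: "metric_on U h" and x: "x \<in> U"
    and l: "linear l"
  shows "\<exists>!u. \<forall>z. h x u z = l z"
proof -
  obtain S :: "'e set" and e where e: "finite S"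
    "\<And>y v. y \<in> U \<Longrightarrow> v = (\<Sum>s\<in>S. h y v (e s y) *\<^sub>R e s y)"
    using orthonormal_frame_UNIV[OF fd h] by metis
  let ?u = "\<Sum>s\<in>S. l (e s x) *\<^sub>R e s x"
  have "h x ?u z = l z" for z
  proof -
    have "h x ?u z = (\<Sum>s\<in>S. h x z (e s x) * l (e s x))"
      using metric_onD(3)[OF h x, of z]
      by (simp add: metric_simps[OF h x] mult.commute)
    also have "\<dots> = l (\<Sum>s\<in>S. h x z (e s x) *\<^sub>R e s x)" using l by (simp add: linear_sum[OF l] linear_scale[OF l])
    also have "\<dots> = l z" by (rule arg_cong[OF e(2)[OF x, of z], symmetric])
    finally show ?thesis .
  qed
  moreover have "u = u'" if "\<forall>z. h x u z = l z" "\<forall>z. h x u' z = l z" for u u'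
    by (rule metric_nondegenerate[OF h x]) (use that in simp)
  ultimately show ?thesis by blast
qed

text \<open>Makes the right-hand side of Koszul's formula a linear functional of z, as
  \<open>riesz\<close> requires.\<close>

lemma linear_D_metric:
  assumes h: "metric_on U h" and x: "x \<in> U"
  shows "linear (\<lambda>z. D (\<lambda>y. h y v z) x a)"
proof -
  note d = has_derivative_D[OF metric_onD(5)[OF h x]]
  have "D (\<lambda>y. h y v (z + z')) x a = D (\<lambda>y. h y v z) x a + D (\<lambda>y. h y v z') x a" for z z'
  proof -
    have "((\<lambda>y. h y v z + h y v z') has_derivative (\<lambda>a. D (\<lambda>y. h y v z) x a + D (\<lambda>y. h y v z') x a)) (at x)"
      by (intro has_derivative_add d)
    then have "((\<lambda>y. h y v (z + z')) has_derivative (\<lambda>a. D (\<lambda>y. h y v z) x a + D (\<lambda>y. h y v z') x a)) (at x)"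
      by (rule has_derivative_transform_within_open[OF _ metric_onD(1)[OF h] x])
        (simp add: metric_simps[OF h])
    then show ?thesis by (simp add: D_eq)
  qed
  moreover have "D (\<lambda>y. h y v (r *\<^sub>R z)) x a = r *\<^sub>R D (\<lambda>y. h y v z) x a" for r z
  proof -
    have "((\<lambda>y. r *\<^sub>R h y v z) has_derivative (\<lambda>a. r *\<^sub>R D (\<lambda>y. h y v z) x a)) (at x)"
      by (intro has_derivative_scaleR_right d)
    then have "((\<lambda>y. h y v (r *\<^sub>R z)) has_derivative (\<lambda>a. r *\<^sub>R D (\<lambda>y. h y v z) x a)) (at x)"
      by (rule has_derivative_transform_within_open[OF _ metric_onD(1)[OF h] x])
        (simp add: metric_simps[OF h])
    then show ?thesis by (simp add: D_eq)
  qed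
  ultimately show ?thesis by (intro linearI) auto
qed

lemma christoffel_eq:
  fixes h :: "'e::real_inner \<Rightarrow> 'e \<Rightarrow> 'e \<Rightarrow> real"
  assumes fd: "\<exists>B::'e set. orthonormal_basis B" and h: "metric_on U h" and x: "x \<in> U"
  shows "2 * h x (christoffel h x v w) z =
    D (\<lambda>y. h y w z) x v + D (\<lambda>y. h y v z) x w - D (\<lambda>y. h y v w) x z"
proof -
  let ?l = "\<lambda>z. (D (\<lambda>y. h y w z) x v + D (\<lambda>y. h y v z) x w - D (\<lambda>y. h y v w) x z) / 2"
  have "linear (\<lambda>z. D (\<lambda>y. h y v w) x z)"
    using has_derivative_linear[OF has_derivative_D[OF metric_onD(5)[OF h x]]] .
  then have l: "linear ?l"
    by (intro linearI)
      (simp_all add: linear_add linear_scale linear_add[OF linear_D_metric[OF h x]]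
        linear_scale[OF linear_D_metric[OF h x]] field_simps)
  have "\<exists>!u. \<forall>z. 2 * h x u z = D (\<lambda>y. h y w z) x v + D (\<lambda>y. h y v z) x w - D (\<lambda>y. h y v w) x z"
    using riesz[OF fd h x l] by (simp add: field_simps)
  from theI'[OF this] show ?thesis unfolding christoffel_def by blast
qed

lemma gradient_eq:
  fixes h :: "'e::real_inner \<Rightarrow> 'e \<Rightarrow> 'e \<Rightarrow> real"
  assumes fd: "\<exists>B::'e set. orthonormal_basis B" and h: "metric_on U h" and x: "x \<in> U"
    and f: "f differentiable (at x)"
  shows "h x (gradient h f x) v = D f x v"
proof -
  from theI'[OF riesz[OF fd h x has_derivative_linear[OF has_derivative_D[OF f]]]]
  show ?thesis unfolding gradient_def by blast
qed

text \<open>In a differentiable orthonormal frame the coefficients of the gradient are the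
  derivatives of f along the frame vectors, so no matrix of the metric has to be inverted.\<close>

lemma gradient_differentiable:
  fixes h :: "'e::real_inner \<Rightarrow> 'e \<Rightarrow> 'e \<Rightarrow> real"
  assumes fd: "\<exists>B::'e set. orthonormal_basis B" and h: "metric_on U h" and x: "x \<in> U"
    and f: "\<And>y. y \<in> U \<Longrightarrow> f differentiable (at y)"
    and f2: "\<And>v. (\<lambda>y. D f y v) differentiable (at x)"
  shows "gradient h f differentiable (at x)"
proof -
  obtain S :: "'e set" and e where e: "finite S"
    "\<And>y s. y \<in> U \<Longrightarrow> s \<in> S \<Longrightarrow> e s differentiable (at y)"
    "\<And>y v. y \<in> U \<Longrightarrow> v = (\<Sum>s\<in>S. h y v (e s y) *\<^sub>R e s y)"
    using orthonormal_frame_UNIV[OF fd h] by metis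
  have eq: "(\<Sum>s\<in>S. D f y (e s y) *\<^sub>R e s y) = gradient h f y" if "y \<in> U" for y
    using e(3)[OF that, of "gradient h f y", symmetric]
    unfolding gradient_eq[OF fd h that f[OF that]] .
  have "(\<lambda>y. D f y (e s y)) differentiable (at x)" if "s \<in> S" for s
    using has_derivative_linear_apply[where T = "D f", OF fd metric_onD(1)[OF h] x _
        has_derivative_D[OF f2] has_derivative_D[OF e(2)[OF x that]]]
      has_derivative_linear[OF has_derivative_D[OF f]] has_derivative_differentiable by blast
  then have "(\<lambda>y. \<Sum>s\<in>S. D f y (e s y) *\<^sub>R e s y) differentiable (at x)"
    using e(1) e(2)[OF x] by (intro differentiable_sum ballI differentiable_scaleR)
  then show ?thesis
    by (rule differentiable_cong_open[OF _ metric_onD(1)[OF h] x eq])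
qed

section \<open>Riemannian submersions in coordinates\<close>

text \<open>With v both as direction and as test vector, the first and last terms of Koszul's
  formula agree by symmetry of h and cancel.\<close>

lemma metric_covariant_derivative:
  fixes h :: "'e::real_inner \<Rightarrow> 'e \<Rightarrow> 'e \<Rightarrow> real"
  assumes "\<exists>B::'e set. orthonormal_basis B" and h: "metric_on U h" and x: "x \<in> U"
  shows "h x (covariant_derivative h v X x) v =
    h x (D X x v) v + D (\<lambda>y. h y v v) x (X x) / 2"
  using christoffel_eq[OF assms, of v "X x" v] D_metric_commute[OF h x, of "X x" v]
  by (simp add: covariant_derivative_def metric_simps[OF h x])

text \<open>Lets \<open>endo_trace_eq\<close> be applied to the divergence. The Christoffel vector
  is known only through its products with all z, so linearity is checked there.\<close>

lemma linear_covariant_derivative: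
  fixes h :: "'e::real_inner \<Rightarrow> 'e \<Rightarrow> 'e \<Rightarrow> real"
  assumes fd: "\<exists>B::'e set. orthonormal_basis B" and h: "metric_on U h" and x: "x \<in> U"
    and X: "X differentiable (at x)"
  shows "linear (\<lambda>v. covariant_derivative h v X x)"
proof -
  note lD = has_derivative_linear[OF has_derivative_D]
  note lD2 = linear_D_metric[OF h x] lD[OF metric_onD(5)[OF h x]]
  note swap = D_metric_commute[OF h x]
  have lD3: "linear (\<lambda>v. D (\<lambda>y. h y v w) x a)" for w a
    using linear_D_metric[OF h x, of w a] by (simp add: swap[of w])
  note c = christoffel_eq[OF fd h x]
  have "christoffel h x (v + w) a = christoffel h x v a + christoffel h x w a" for v w a
  proof (rule metric_nondegenerate[OF h x])
    fix z
    show "h x (christoffel h x (v + w) a) z = h x (christoffel h x v a + christoffel h x w a) z"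
      using c[of "v + w" a z] c[of v a z] c[of w a z]
      by (simp add: metric_simps[OF h x] linear_add[OF lD2(1)] linear_add[OF lD2(2)] linear_add[OF lD3])
  qed
  moreover have "christoffel h x (r *\<^sub>R v) a = r *\<^sub>R christoffel h x v a" for r v a
  proof (rule metric_nondegenerate[OF h x])
    fix z
    have "2 * h x (christoffel h x (r *\<^sub>R v) a) z = r * (2 * h x (christoffel h x v a) z)"
      unfolding c
      by (simp add: linear_scale[OF lD2(1)] linear_scale[OF lD2(2)] linear_scale[OF lD3] algebra_simps)
    then show "h x (christoffel h x (r *\<^sub>R v) a) z = h x (r *\<^sub>R christoffel h x v a) z"
      by (simp add: metric_simps[OF h x])
  qed
  ultimately show ?thesis
    unfolding covariant_derivative_def
    by (intro linearI) (simp_all add: linear_add[OF lD[OF X]] linear_scale[OF lD[OF X]] algebra_simps)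
qed

text \<open>Differentiating \<open>h (X, Z) = 0\<close> in the direction \<open>Z\<close> moves the covariant derivative
  from \<open>X\<close> to \<open>Z\<close>.\<close>
lemma covariant_derivative_orthogonal:
  fixes h :: "'e::real_inner \<Rightarrow> 'e \<Rightarrow> 'e \<Rightarrow> real"
  assumes fd: "\<exists>B::'e set. orthonormal_basis B" and h: "metric_on U h" and x: "x \<in> U"
    and X: "X differentiable (at x)" and Z: "Z differentiable (at x)"
    and V: "open V" "x \<in> V" and orth: "\<And>y. y \<in> V \<Longrightarrow> h y (X y) (Z y) = 0"
  shows "h x (covariant_derivative h (Z x) X x) (Z x) =
    - h x (X x) (covariant_derivative h (Z x) Z x)"
proof -
  let ?z = "Z x"
  have "((\<lambda>y. h y (X y) (Z y)) has_derivative (\<lambda>v. 0)) (at x)"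
    by (rule has_derivative_transform_within_open[OF _ V]) (use orth in \<open>auto intro: has_derivative_const\<close>)
  from fun_cong[OF has_derivative_unique[OF has_derivative_metric[OF fd h x has_derivative_D[OF X] has_derivative_D[OF Z]] this], of ?z]
  have 1: "D (\<lambda>y. h y (X x) ?z) x ?z + h x (D X x ?z) ?z + h x (X x) (D Z x ?z) = 0" .
  note swap = D_metric_commute[OF h x]
  \<comment> \<open>By fact 1 the right-hand side equals - h (DX z, z) - D_X h (z, z) / 2, the
    negative of the diagonal formula for X.\<close>
  have 2: "h x (X x) (covariant_derivative h ?z Z x) =
      h x (X x) (D Z x ?z) + D (\<lambda>y. h y (X x) ?z) x ?z - D (\<lambda>y. h y ?z ?z) x (X x) / 2"
    using christoffel_eq[OF fd h x, of ?z ?z "X x"] metric_onD(3)[OF h x, of "X x"] swap[of "X x"]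
    by (simp add: covariant_derivative_def metric_simps[OF h x])
  show ?thesis using 1 2 metric_covariant_derivative[OF fd h x, of ?z X] by simp
qed

section \<open>Linear algebra of a Riemannian submersion at one point\<close>

definition horizontal_at :: "('e::real_inner \<Rightarrow> 'e \<Rightarrow> real) \<Rightarrow> ('e \<Rightarrow> 'f::real_inner) \<Rightarrow> 'e \<Rightarrow> bool" where
  "horizontal_at q T v \<longleftrightarrow> (\<forall>z. T z = 0 \<longrightarrow> q v z = 0)"

definition coisometry ::
    "('e::real_inner \<Rightarrow> 'e \<Rightarrow> real) \<Rightarrow> ('f::real_inner \<Rightarrow> 'f \<Rightarrow> real) \<Rightarrow> ('e \<Rightarrow> 'f) \<Rightarrow> bool" where
  "coisometry q r T \<longleftrightarrow> linear T \<and> surj T \<and>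
     (\<forall>v w. horizontal_at q T v \<longrightarrow> horizontal_at q T w \<longrightarrow> r (T v) (T w) = q v w)"

text \<open>Subtract from v its q-orthogonal projection to the kernel of T.\<close>

lemma horizontal_part_exists:
  fixes q :: "'e::real_inner \<Rightarrow> 'e \<Rightarrow> real"
  assumes fd: "\<exists>B::'e set. orthonormal_basis B"
    and q: "bilinear q" "\<And>v w. q v w = q w v" "\<And>v. v \<noteq> 0 \<Longrightarrow> q v v > 0"
    and T: "linear (T :: 'e \<Rightarrow> 'f::real_inner)"
  shows "\<exists>a. horizontal_at q T a \<and> T a = T v"
proof -
  have qm: "metric_on (UNIV::'e set) (\<lambda>_. q)"
    using q unfolding metric_on_def by (auto intro: differentiable_const)
  note qs = metric_simps[OF qm UNIV_I]
  obtain S where S: "S \<subseteq> {v. T v = 0}" "\<And>v. v \<in> {v. T v = 0} \<Longrightarrow> v = (\<Sum>s\<in>S. q v s *\<^sub>R s)"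
    using orthonormal_subspace_basis[OF fd q linear_subspace_kernel[OF T]] by metis
  let ?a = "v - (\<Sum>s\<in>S. q v s *\<^sub>R s)"
  have "q ?a z = 0" if "T z = 0" for z
  proof -
    have zs: "z = (\<Sum>s\<in>S. q z s *\<^sub>R s)" using S(2) that by simp
    have "q v (\<Sum>s\<in>S. q z s *\<^sub>R s) = (\<Sum>s\<in>S. q v s * q s z)"
      using q(2)[of z] by (simp add: qs mult.commute)
    then show ?thesis unfolding zs[symmetric] by (simp add: qs)
  qed
  moreover have "T ?a = T v"
    using S(1) by (auto simp: linear_diff[OF T] linear_sum[OF T] linear_scale[OF T] intro!: sum.neutral)
  ultimately show ?thesis unfolding horizontal_at_def by blast
qed

text \<open>One horizontal vector is enough: passing from v to its horizontal part changes neither T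
  v nor q v w.\<close>

lemma coisometry_horizontal:
  fixes q :: "'e::real_inner \<Rightarrow> 'e \<Rightarrow> real"
  assumes fd: "\<exists>B::'e set. orthonormal_basis B"
    and q: "bilinear q" "\<And>v w. q v w = q w v" "\<And>v. v \<noteq> 0 \<Longrightarrow> q v v > 0"
    and T: "coisometry q r T" and w: "horizontal_at q T w"
  shows "r (T v) (T w) = q v w"
proof -
  have lT: "linear T" using T by (simp add: coisometry_def)
  obtain a where a: "horizontal_at q T a" "T a = T v"
    using horizontal_part_exists[OF fd q lT] by blast
  have "q w (v - a) = 0" using w a(2) by (simp add: horizontal_at_def linear_diff[OF lT])
  then have "q v w = q a w" using q(2)[of w] by (simp add: bilinear_rsub[OF q(1)])
  moreover have "r (T a) (T w) = q a w" using T a(1) w unfolding coisometry_def by blast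
  ultimately show ?thesis using a(2) by simp
qed

text \<open>Pythagoras: T preserves the length of the horizontal part and forgets the vertical part.
  This is the inequality behind the minimum argument.\<close>

lemma coisometry_le:
  fixes q :: "'e::real_inner \<Rightarrow> 'e \<Rightarrow> real"
  assumes fd: "\<exists>B::'e set. orthonormal_basis B"
    and q: "bilinear q" "\<And>v w. q v w = q w v" "\<And>v. v \<noteq> 0 \<Longrightarrow> q v v > 0"
    and T: "coisometry q r T"
  shows "r (T v) (T v) \<le> q v v"
proof -
  have lT: "linear T" using T by (simp add: coisometry_def)
  obtain a where a: "horizontal_at q T a" "T a = T v"
    using horizontal_part_exists[OF fd q lT] by blast
  have "q a (v - a) = 0" using a by (simp add: horizontal_at_def linear_diff[OF lT])
  then have "q v v = q a a + q (v - a) (v - a)"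
    using q(2)[of v a] by (simp add: bilinear_rsub[OF q(1)] bilinear_lsub[OF q(1)])
  moreover have "q (v - a) (v - a) \<ge> 0"
    using q(3)[of "v - a"] bilinear_lzero[OF q(1)] by (cases "v - a = 0") auto
  moreover have "r (T a) (T a) = q a a" using T a(1) unfolding coisometry_def by blast
  ultimately show ?thesis using a(2) by simp
qed

lemma coisometry_lift:
  fixes q :: "'e::real_inner \<Rightarrow> 'e \<Rightarrow> real"
  assumes fd: "\<exists>B::'e set. orthonormal_basis B"
    and q: "bilinear q" "\<And>v w. q v w = q w v" "\<And>v. v \<noteq> 0 \<Longrightarrow> q v v > 0"
    and T: "coisometry q r T"
  shows "\<exists>e. horizontal_at q T e \<and> T e = b"
proof -
  have lT: "linear T" using T by (simp add: coisometry_def)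
  obtain v where "T v = b" using T unfolding coisometry_def by (metis surjD)
  then show ?thesis using horizontal_part_exists[OF fd q lT, of v] by simp
qed

text \<open>At a horizontal vector the nonnegative function \<open>h (e, e) - k (DF e, DF e)\<close> attains its
  minimum \<open>0\<close>, so its derivative vanishes.  This replaces differentiating the horizontal
  projection.\<close>
lemma D_metric_coisometry:
  fixes h :: "'e::real_inner \<Rightarrow> 'e \<Rightarrow> 'e \<Rightarrow> real" and k :: "'f::real_inner \<Rightarrow> 'f \<Rightarrow> 'f \<Rightarrow> real"
  assumes fdE: "\<exists>B::'e set. orthonormal_basis B" and fdF: "\<exists>B::'f set. orthonormal_basis B"
    and h: "metric_on U h" and k: "metric_on V k" and x: "x \<in> U" and F: "F ` U \<subseteq> V"
    and F1: "\<And>y. y \<in> U \<Longrightarrow> F differentiable (at y)"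
    and F2: "\<And>w. (\<lambda>y. D F y w) differentiable (at x)"
    and co: "\<And>y. y \<in> U \<Longrightarrow> coisometry (h y) (k (F y)) (D F y)"
    and e: "horizontal_at (h x) (D F x) e"
  shows "D (\<lambda>y. h y e e) x v = D (\<lambda>y. k y (D F x e) (D F x e)) (F x) (D F x v)
    + 2 * k (F x) (D (\<lambda>y. D F y e) x v) (D F x e)"
proof -
  note hx = metric_onD(2,3,4)[OF h]
  have Fx: "F x \<in> V" using x F by auto
  let ?b = "D F x e"
  \<comment> \<open>The metric of the base read along F is a family over U, so the Leibniz rule
    applies to it there.\<close>
  have kF: "metric_on U (\<lambda>y. k (F y))"
    unfolding metric_on_def
  proof (intro conjI ballI allI impI)
    fix y v w assume y: "y \<in> U"
    then have Fy: "F y \<in> V" using F by auto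
    show "bilinear (k (F y))" "k (F y) v w = k (F y) w v" "v \<noteq> 0 \<Longrightarrow> 0 < k (F y) v v"
      using metric_onD(2,3,4)[OF k Fy] by auto
    show "(\<lambda>y. k (F y) v w) differentiable at y"
      using differentiable_chain_at[OF F1[OF y] metric_onD(5)[OF k Fy]] by (simp add: o_def)
  qed (use metric_onD(1)[OF h] in auto)
  have 1: "((\<lambda>y. k (F y) (D F y e) (D F y e)) has_derivative
    (\<lambda>v. D (\<lambda>y. k (F y) ?b ?b) x v + k (F x) (D (\<lambda>y. D F y e) x v) ?b
      + k (F x) ?b (D (\<lambda>y. D F y e) x v))) (at x)"
    using has_derivative_metric[OF fdF kF x has_derivative_D[OF F2] has_derivative_D[OF F2]] .
  have 2: "D (\<lambda>y. k (F y) ?b ?b) x = (\<lambda>v. D (\<lambda>y. k y ?b ?b) (F x) (D F x v))"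
    using diff_chain_at[OF has_derivative_D[OF F1[OF x]] has_derivative_D[OF metric_onD(5)[OF k Fx]]]
    by (intro D_eq) (simp add: o_def)
  let ?g = "\<lambda>y. h y e e - k (F y) (D F y e) (D F y e)"
  let ?g' = "\<lambda>v. D (\<lambda>y. h y e e) x v - (D (\<lambda>y. k y ?b ?b) (F x) (D F x v) +
      2 * k (F x) (D (\<lambda>y. D F y e) x v) ?b)"
  have "(?g has_derivative ?g') (at x)"
    using has_derivative_diff[OF has_derivative_D[OF metric_onD(5)[OF h x, of e e]] 1]
      metric_onD(3)[OF k Fx, of ?b] 2 by (simp add: add.assoc)
  \<comment> \<open>The fixed vector e is horizontal at x, where equality holds; at other points it
    need not be, and the inequality takes over.\<close>
  moreover have "?g x \<le> ?g y" if "y \<in> U" for y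
  proof -
    have "?g x = 0" using co[OF x] e unfolding coisometry_def by simp
    moreover have "?g y \<ge> 0" using coisometry_le[OF fdE hx[OF that] co[OF that], of e] that by simp
    ultimately show ?thesis by simp
  qed
  then have "\<forall>y\<in>U. ?g x \<le> ?g y" by blast
  ultimately have "?g' = (\<lambda>v. 0)"
    using differential_zero_maxmin[OF x metric_onD(1)[OF h]] by blast
  from fun_cong[OF this, of v] show ?thesis by simp
qed

text \<open>The pull-back formula in coordinates. The assumption \<open>vert\<close> is what a
  totally geodesic fibre through the point provides, and \<open>sym\<close> is the symmetry of the
  second derivative of F.\<close>

theorem divergence_gradient_submersion:
  fixes h :: "'e::real_inner \<Rightarrow> 'e \<Rightarrow> 'e \<Rightarrow> real" and k :: "'f::real_inner \<Rightarrow> 'f \<Rightarrow> 'f \<Rightarrow> real"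
  assumes fdE: "\<exists>B::'e set. orthonormal_basis B" and fdF: "\<exists>B::'f set. orthonormal_basis B"
    and h: "metric_on U h" and k: "metric_on V k" and x: "x \<in> U" and F: "F ` U \<subseteq> V"
    and F1: "\<And>y. y \<in> U \<Longrightarrow> F differentiable (at y)"
    and F2: "\<And>y w. y \<in> U \<Longrightarrow> (\<lambda>y. D F y w) differentiable (at y)"
    and sym: "\<And>v w. D (\<lambda>y. D F y w) x v = D (\<lambda>y. D F y v) x w"
    and co: "\<And>y. y \<in> U \<Longrightarrow> coisometry (h y) (k (F y)) (D F y)"
    and vert: "\<And>z. D F x z = 0 \<Longrightarrow> \<exists>Z W. Z differentiable (at x) \<and> Z x = z \<and> open W \<and> x \<in> W \<and>
       W \<subseteq> U \<and> (\<forall>y\<in>W. D F y (Z y) = 0) \<and> D F x (covariant_derivative h z Z x) = 0"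
    and u1: "\<And>y. y \<in> V \<Longrightarrow> u differentiable (at y)"
    and u2: "\<And>y w. y \<in> V \<Longrightarrow> (\<lambda>y. D u y w) differentiable (at y)"
  shows "divergence h (gradient h (u \<circ> F)) x = divergence k (gradient k u) (F x)"
proof -
  note hx = metric_onD(2,3,4)[OF h]
  have FV: "F y \<in> V" if "y \<in> U" for y using F that by auto
  have Fx: "F x \<in> V" using FV[OF x] .
  note lF = has_derivative_linear[OF has_derivative_D[OF F1]]
  let ?X = "gradient h (u \<circ> F)" and ?Y = "gradient k u"
  have uF: "D (u \<circ> F) y v = D u (F y) (D F y v)" if "y \<in> U" for y v
    using D_eq[OF diff_chain_at[OF has_derivative_D[OF F1[OF that]] has_derivative_D[OF u1[OF FV[OF that]]]]]
    by simp
  have uF1: "(u \<circ> F) differentiable (at y)" if "y \<in> U" for y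
    using differentiable_chain_at[OF F1[OF that] u1[OF FV[OF that]]] .
  have uF2: "(\<lambda>y. D (u \<circ> F) y v) differentiable (at x)" for v
  proof -
    have "((\<lambda>y. D u (F y) w) has_derivative (\<lambda>a. D (\<lambda>y. D u y w) (F x) (D F x a))) (at x)" for w
      using diff_chain_at[OF has_derivative_D[OF F1[OF x]] has_derivative_D[OF u2[OF Fx]]]
      by (simp add: o_def)
    from has_derivative_linear_apply[where T = "\<lambda>y. D u (F y)", OF fdF metric_onD(1)[OF h] x _ this
        has_derivative_D[OF F2[OF x]]] has_derivative_linear[OF has_derivative_D[OF u1[OF FV]]]
    have "((\<lambda>y. D u (F y) (D F y v)) has_derivative
       (\<lambda>a. D (\<lambda>y. D u y (D F x v)) (F x) (D F x a) + D u (F x) (D (\<lambda>y. D F y v) x a))) (at x)"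
      by simp
    then have "((\<lambda>y. D (u \<circ> F) y v) has_derivative
       (\<lambda>a. D (\<lambda>y. D u y (D F x v)) (F x) (D F x a) + D u (F x) (D (\<lambda>y. D F y v) x a))) (at x)"
      by (rule has_derivative_transform_within_open[OF _ metric_onD(1)[OF h] x]) (simp add: uF)
    then show ?thesis by (rule has_derivative_differentiable)
  qed
  have Xd: "?X differentiable (at x)" by (rule gradient_differentiable[OF fdE h x uF1 uF2])
  have Yd: "?Y differentiable (at (F x))" by (rule gradient_differentiable[OF fdF k Fx u1 u2[OF Fx]])
  have Xeq: "h y (?X y) v = D u (F y) (D F y v)" if "y \<in> U" for y v
    using gradient_eq[OF fdE h that uF1[OF that]] uF[OF that] by simp
  have Xhor: "horizontal_at (h y) (D F y) (?X y)" if "y \<in> U" for y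
    using Xeq[OF that] linear_0[OF has_derivative_linear[OF has_derivative_D[OF u1[OF FV[OF that]]]]]
    by (simp add: horizontal_at_def)
  \<comment> \<open>X is the horizontal lift of Y: every test vector b on the base is lifted to a
    horizontal a, and both products become the derivative of u along b.\<close>
  have XY: "D F y (?X y) = ?Y (F y)" if y: "y \<in> U" for y
  proof (rule metric_nondegenerate[OF k FV[OF y]])
    fix b
    obtain a where a: "horizontal_at (h y) (D F y) a" "D F y a = b"
      using coisometry_lift[OF fdE hx[OF y] co[OF y]] by blast
    have "k (F y) (D F y (?X y)) (D F y a) = h y (?X y) a"
      using coisometry_horizontal[OF fdE hx[OF y] co[OF y] a(1)] y by simp
    then show "k (F y) (D F y (?X y)) b = k (F y) (?Y (F y)) b"
      using Xeq[OF y] gradient_eq[OF fdF k FV[OF y] u1[OF FV[OF y]]] a(2) by simp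
  qed
  have DXY: "D F x (D ?X x v) = D ?Y (F x) (D F x v) - D (\<lambda>y. D F y (?X x)) x v" for v
  proof -
    have 1: "((\<lambda>y. D F y (?X y)) has_derivative
        (\<lambda>v. D (\<lambda>y. D F y (?X x)) x v + D F x (D ?X x v))) (at x)"
      by (rule has_derivative_linear_apply[where T = "D F", OF fdE metric_onD(1)[OF h] x lF
            has_derivative_D[OF F2[OF x]] has_derivative_D[OF Xd]])
    have "((\<lambda>y. ?Y (F y)) has_derivative (\<lambda>v. D ?Y (F x) (D F x v))) (at x)"
      using diff_chain_at[OF has_derivative_D[OF F1[OF x]] has_derivative_D[OF Yd]] by (simp add: o_def)
    then have "((\<lambda>y. D F y (?X y)) has_derivative (\<lambda>v. D ?Y (F x) (D F x v))) (at x)"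
      by (rule has_derivative_transform_within_open[OF _ metric_onD(1)[OF h] x]) (simp add: XY)
    from fun_cong[OF has_derivative_unique[OF 1 this], of v] show ?thesis by (simp add: algebra_simps)
  qed
  let ?T = "D F x"
  note hd = hx[OF x]
  obtain B :: "'f set" and bf where B: "finite B"
    "\<And>v. v = (\<Sum>s\<in>B. k (F x) v (bf s) *\<^sub>R bf s)"
    using orthonormal_frame_UNIV[OF fdF k] Fx by metis
  obtain S where S0: "finite S" "S \<subseteq> {v. ?T v = 0}"
    "\<And>v. v \<in> {v. ?T v = 0} \<Longrightarrow> v = (\<Sum>s\<in>S. h x v s *\<^sub>R s)"
    using orthonormal_subspace_basis[OF fdE hd linear_subspace_kernel[OF lF[OF x]]] by metis
  have S: "finite S" "\<And>s. s \<in> S \<Longrightarrow> ?T s = 0" using S0(1,2) by auto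
  have S3: "v = (\<Sum>s\<in>S. h x v s *\<^sub>R s)" if "?T v = 0" for v using S0(3)[of v] that by blast
  have "\<forall>s. \<exists>e. horizontal_at (h x) ?T e \<and> ?T e = bf s"
    using coisometry_lift[OF fdE hd co[OF x]] by blast
  then obtain e where e: "\<And>s. horizontal_at (h x) ?T (e s)" "\<And>s. ?T (e s) = bf s" by metis
  have ke: "k (F x) (?T v) (bf s) = h x v (e s)" for v s
    using coisometry_horizontal[OF fdE hd co[OF x] e(1)[of s], of v] e(2) x by simp
  \<comment> \<open>Removing the lifts of the coordinates of DF v leaves a vertical w. Its
    coordinates in S are those of v, since the lifts are orthogonal to S. The disjoint sum keeps the
    two index sets apart.\<close>
  have expand: "v = (\<Sum>i\<in>B <+> S. h x v (case i of Inl s \<Rightarrow> e s | Inr s \<Rightarrow> s) *\<^sub>R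
      (case i of Inl s \<Rightarrow> e s | Inr s \<Rightarrow> s))" for v
  proof -
    define w where "w = v - (\<Sum>s\<in>B. h x v (e s) *\<^sub>R e s)"
    have "?T w = ?T v - (\<Sum>s\<in>B. k (F x) (?T v) (bf s) *\<^sub>R bf s)"
      by (simp add: w_def linear_diff[OF lF[OF x]] linear_sum[OF lF[OF x]] linear_scale[OF lF[OF x]] e(2) ke)
    also have "\<dots> = 0" using B(2)[of "?T v", symmetric] by simp
    finally have "w = (\<Sum>s\<in>S. h x w s *\<^sub>R s)" by (rule S3)
    also have "\<dots> = (\<Sum>s\<in>S. h x v s *\<^sub>R s)"
    proof (rule sum.cong[OF refl])
      fix s assume "s \<in> S"
      then have "h x (e t) s = 0" for t using e(1)[of t] S(2) by (simp add: horizontal_at_def)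
      then show "h x w s *\<^sub>R s = h x v s *\<^sub>R s" by (simp add: w_def metric_simps[OF h x])
    qed
    finally have "v = (\<Sum>s\<in>B. h x v (e s) *\<^sub>R e s) + (\<Sum>s\<in>S. h x v s *\<^sub>R s)"
      by (simp add: w_def algebra_simps)
    then show ?thesis by (simp add: sum.Plus[OF B(1) S(1)])
  qed
  let ?L = "\<lambda>v. covariant_derivative h v ?X x"
  have "divergence h ?X x = (\<Sum>i\<in>B <+> S.
      h x (?L (case i of Inl s \<Rightarrow> e s | Inr s \<Rightarrow> s)) (case i of Inl s \<Rightarrow> e s | Inr s \<Rightarrow> s))"
    unfolding divergence_def
    by (rule endo_trace_eq[OF linear_covariant_derivative[OF fdE h x Xd] fdE
          finite_Plus[OF B(1) S(1)] metric_on_linear(2)[OF h x] expand])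
  also have "\<dots> = (\<Sum>s\<in>B. h x (?L (e s)) (e s)) + (\<Sum>s\<in>S. h x (?L s) s)"
    by (simp add: sum.Plus[OF B(1) S(1)])
  also have "(\<Sum>s\<in>S. h x (?L s) s) = 0"
  proof (rule sum.neutral, rule ballI)
    fix s assume "s \<in> S"
    then obtain Z W where Z: "Z differentiable (at x)" "Z x = s" "open W" "x \<in> W" "W \<subseteq> U"
      "\<forall>y\<in>W. D F y (Z y) = 0" "?T (covariant_derivative h s Z x) = 0"
      using vert[OF S(2)] by blast
    have "h y (?X y) (Z y) = 0" if "y \<in> W" for y
      using Xhor[of y] that Z(5,6) unfolding horizontal_at_def by blast
    from covariant_derivative_orthogonal[OF fdE h x Xd Z(1,3,4) this]
    have "h x (?L s) s = - h x (?X x) (covariant_derivative h s Z x)" using Z(2) by simp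
    then show "h x (?L s) s = 0" using Xhor[OF x] Z(7) by (simp add: horizontal_at_def)
  qed
  also have "(\<Sum>s\<in>B. h x (?L (e s)) (e s)) =
      (\<Sum>s\<in>B. k (F x) (covariant_derivative k (bf s) ?Y (F x)) (bf s))"
  proof (rule sum.cong[OF refl])
    fix s
    have "h x (?L (e s)) (e s) = k (F x) (?T (D ?X x (e s))) (bf s) + D (\<lambda>y. h y (e s) (e s)) x (?X x) / 2"
      using metric_covariant_derivative[OF fdE h x, of "e s" ?X] by (simp add: ke)
    also have "k (F x) (?T (D ?X x (e s))) (bf s) =
        k (F x) (D ?Y (F x) (bf s)) (bf s) - k (F x) (D (\<lambda>y. D F y (?X x)) x (e s)) (bf s)"
      by (simp add: DXY e(2) metric_simps[OF k Fx])
    also have "D (\<lambda>y. h y (e s) (e s)) x (?X x) = D (\<lambda>y. k y (bf s) (bf s)) (F x) (?Y (F x))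
        + 2 * k (F x) (D (\<lambda>y. D F y (?X x)) x (e s)) (bf s)"
      using D_metric_coisometry[OF fdE fdF h k x F F1 F2[OF x] co e(1)[of s], of "?X x"]
      by (simp add: e(2) XY[OF x] sym[of "e s"])
    finally show "h x (?L (e s)) (e s) = k (F x) (covariant_derivative k (bf s) ?Y (F x)) (bf s)"
      using metric_covariant_derivative[OF fdF k Fx, of "bf s" ?Y] by argo
  qed
  also have "\<dots> = divergence k ?Y (F x)"
    unfolding divergence_def
    by (rule endo_trace_eq[symmetric, OF linear_covariant_derivative[OF fdF k Fx Yd] fdF
          B(1) metric_on_linear(2)[OF k Fx] B(2)])
  finally show ?thesis by (simp add: o_def)
qed

section \<open>Smooth maps between vector spaces\<close>

lemma Ck_on_subset: "Ck_on k U f \<Longrightarrow> V \<subseteq> U \<Longrightarrow> Ck_on k V f"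
  by (induction k arbitrary: f) (auto intro: continuous_on_subset)

lemma Ck_on_cong:
  assumes "open U" "Ck_on k U f" "\<And>x. x \<in> U \<Longrightarrow> f x = g x"
  shows "Ck_on k U g"
  using assms(2,3)
proof (induction k arbitrary: f g)
  case 0
  then show ?case by (simp cong: continuous_on_cong)
next
  case (Suc k)
  have f: "f differentiable (at x)" if "x \<in> U" for x using Suc.prems(1) that by simp
  have eq: "D f x = D g x" if "x \<in> U" for x
    by (rule D_cong_open[OF f[OF that] \<open>open U\<close> that Suc.prems(2)])
  have "Ck_on k U (\<lambda>x. D g x v)" for v
  proof (rule Suc.IH)
    show "Ck_on k U (\<lambda>x. D f x v)" using Suc.prems(1) by simp
    show "D f x v = D g x v" if "x \<in> U" for x by (rule fun_cong[OF eq[OF that]])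
  qed
  moreover have "g differentiable (at x)" if "x \<in> U" for x
    by (rule differentiable_cong_open[OF f[OF that] \<open>open U\<close> that Suc.prems(2)])
  ultimately show ?case by simp
qed

lemma Ck_on_local:
  assumes "\<And>x. x \<in> U \<Longrightarrow> \<exists>V. open V \<and> x \<in> V \<and> Ck_on k V f"
  shows "Ck_on k U f"
  using assms
proof (induction k arbitrary: f)
  case 0
  have "isCont f x" if "x \<in> U" for x
    using 0[OF that] by (auto simp: continuous_on_eq_continuous_at)
  then show ?case by (simp add: continuous_at_imp_continuous_on)
next
  case (Suc k)
  have "Ck_on k U (\<lambda>x. D f x v)" for v
    by (rule Suc.IH) (use Suc.prems in fastforce)
  moreover have "f differentiable (at x)" if "x \<in> U" for x
    using Suc.prems[OF that] by auto
  ultimately show ?case by simp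
qed

text \<open>Lets the closure proofs work with an explicit derivative f', to which the induction
  hypothesis can be applied directly.\<close>

lemma Ck_on_SucI:
  assumes "open U" "\<And>x. x \<in> U \<Longrightarrow> (f has_derivative f' x) (at x)"
    and "\<And>v. Ck_on k U (\<lambda>x. f' x v)"
  shows "Ck_on (Suc k) U f"
proof -
  have "Ck_on k U (\<lambda>x. D f x v)" for v
    by (rule Ck_on_cong[OF assms(1,3)]) (simp add: D_eq[OF assms(2)])
  then show ?thesis using assms(2) has_derivative_differentiable by fastforce
qed

lemma Ck_on_has_derivative:
  "Ck_on (Suc k) U f \<Longrightarrow> x \<in> U \<Longrightarrow> (f has_derivative D f x) (at x)"
  by (rule has_derivative_D) simp

lemma Ck_on_continuous: "Ck_on k U f \<Longrightarrow> continuous_on U f"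
  by (cases k) (auto intro!: continuous_at_imp_continuous_on differentiable_imp_continuous_within)

lemma Ck_on_Suc_imp: "Ck_on (Suc k) U f \<Longrightarrow> Ck_on k U f"
proof (induction k arbitrary: f)
  case 0
  then show ?case using Ck_on_continuous by fastforce
next
  case (Suc k)
  have "Ck_on k U (\<lambda>x. D f x v)" for v
    by (rule Suc.IH) (use Suc.prems in simp)
  then show ?case using Suc.prems by simp
qed

lemma Ck_on_const: "Ck_on k U (\<lambda>_. c)"
  by (induction k arbitrary: c) auto

lemma Ck_on_bounded_linear:
  assumes "open U" "bounded_linear L" "Ck_on k U f"
  shows "Ck_on k U (\<lambda>x. L (f x))"
  using assms(3)
proof (induction k arbitrary: f)
  case 0
  then show ?case by (simp add: bounded_linear.continuous_on[OF assms(2)])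
next
  case (Suc k)
  show ?case
    by (rule Ck_on_SucI[OF assms(1) bounded_linear.has_derivative[OF assms(2)
          Ck_on_has_derivative[OF Suc.prems]] Suc.IH]) (use Suc.prems in auto)
qed

lemma Ck_on_add:
  assumes "open U" "Ck_on k U f" "Ck_on k U g"
  shows "Ck_on k U (\<lambda>x. f x + g x)"
  using assms(2,3)
proof (induction k arbitrary: f g)
  case (Suc k)
  show ?case
    by (rule Ck_on_SucI[OF assms(1) has_derivative_add[OF Ck_on_has_derivative[OF Suc.prems(1)]
          Ck_on_has_derivative[OF Suc.prems(2)]] Suc.IH]) (use Suc.prems in auto)
qed (auto intro: continuous_on_add)

lemma Ck_on_sum:
  assumes "open U" "finite I" "\<And>i. i \<in> I \<Longrightarrow> Ck_on k U (f i)"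
  shows "Ck_on k U (\<lambda>x. \<Sum>i\<in>I. f i x)"
  using assms(2,3)
  by (induction I) (auto intro: Ck_on_const Ck_on_add[OF assms(1)])

lemma Ck_on_scaleR:
  fixes a :: "'a::real_normed_vector \<Rightarrow> real"
  assumes "open U" "Ck_on k U a" "Ck_on k U f"
  shows "Ck_on k U (\<lambda>x. a x *\<^sub>R f x)"
  using assms(2,3)
proof (induction k arbitrary: a f)
  case (Suc k)
  show ?case
  proof (rule Ck_on_SucI[OF assms(1) has_derivative_scaleR[OF Ck_on_has_derivative[OF Suc.prems(1)]
          Ck_on_has_derivative[OF Suc.prems(2)]]])
    fix v
    show "Ck_on k U (\<lambda>x. a x *\<^sub>R D f x v + D a x v *\<^sub>R f x)"
      by (intro Ck_on_add[OF assms(1)] Suc.IH Ck_on_Suc_imp[OF Suc.prems(1)]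
          Ck_on_Suc_imp[OF Suc.prems(2)]) (use Suc.prems in simp_all)
  qed
qed (auto intro: continuous_on_scaleR)

text \<open>\<open>Ck_on\<close> differentiates along fixed vectors, while the chain rule applies D
  g (f x) to the moving vector D f x v. Expanding that vector in a basis gives a sum of products of
  functions already known to be of class k.\<close>

lemma Ck_on_compose:
  fixes f :: "'a::real_normed_vector \<Rightarrow> 'b::real_inner" and g :: "'b \<Rightarrow> 'c::real_normed_vector"
  assumes fd: "\<exists>B::'b set. orthonormal_basis B" and U: "open U" and fU: "f ` U \<subseteq> V"
    and "Ck_on k U f" "Ck_on k V g"
  shows "Ck_on k U (\<lambda>x. g (f x))"
  using assms(4,5)
proof (induction k arbitrary: g)
  case 0
  then show ?case using fU by (auto intro: continuous_on_compose2)
next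
  case (Suc k)
  obtain B :: "'b set" where B: "orthonormal_basis B" using fd by blast
  have d: "((\<lambda>x. g (f x)) has_derivative (\<lambda>v. D g (f x) (D f x v))) (at x)" if "x \<in> U" for x
  proof -
    have "f x \<in> V" using that fU by auto
    then show ?thesis
      using diff_chain_at[OF Ck_on_has_derivative[OF Suc.prems(1) that]
          Ck_on_has_derivative[OF Suc.prems(2)]] by (simp add: o_def)
  qed
  show ?case
  proof (rule Ck_on_SucI[OF U d])
    fix v
    have "Ck_on k U (\<lambda>x. \<Sum>b\<in>B. inner (D f x v) b *\<^sub>R D g (f x) b)"
    proof (intro Ck_on_sum[OF U orthonormal_basis_finite[OF B]] Ck_on_scaleR[OF U])
      fix b
      show "Ck_on k U (\<lambda>x. inner (D f x v) b)"
        by (rule Ck_on_bounded_linear[OF U bounded_linear_inner_left]) (use Suc.prems in simp)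
      show "Ck_on k U (\<lambda>x. D g (f x) b)"
        by (rule Suc.IH[OF Ck_on_Suc_imp[OF Suc.prems(1)]]) (use Suc.prems in simp)
    qed
    then show "Ck_on k U (\<lambda>x. D g (f x) (D f x v))"
    proof (rule Ck_on_cong[OF U])
      fix x assume "x \<in> U"
      then have "f x \<in> V" using fU by auto
      then have "linear (D g (f x))"
        using has_derivative_linear[OF Ck_on_has_derivative[OF Suc.prems(2)]] by blast
      from linear_expand[OF B this, symmetric]
      show "(\<Sum>b\<in>B. inner (D f x v) b *\<^sub>R D g (f x) b) = D g (f x) (D f x v)" .
    qed
  qed
qed

text \<open>Two applications of the mean value theorem, along v and then along w. All points met lie
  in the ball because both steps are at most t.\<close>

lemma mixed_difference_quotient:
  fixes f :: "'a::real_normed_vector \<Rightarrow> real"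
  assumes f: "Ck_on (Suc (Suc 0)) (ball x r) f" and t: "t > 0" "t * (norm v + norm w) < r"
  shows "\<exists>\<xi>. norm (\<xi> - x) \<le> t * (norm v + norm w) \<and>
    f (x + t *\<^sub>R v + t *\<^sub>R w) - f (x + t *\<^sub>R v) - f (x + t *\<^sub>R w) + f x = t * t * D (\<lambda>y. D f y v) \<xi> w"
proof -
  have n: "norm (s *\<^sub>R v + s' *\<^sub>R w) \<le> t * (norm v + norm w)" if "0 \<le> s" "s \<le> t" "0 \<le> s'" "s' \<le> t" for s s'
  proof -
    have "norm (s *\<^sub>R v + s' *\<^sub>R w) \<le> s * norm v + s' * norm w"
      using norm_triangle_ineq[of "s *\<^sub>R v" "s' *\<^sub>R w"] that by simp
    also have "\<dots> \<le> t * norm v + t * norm w"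
      using that by (intro add_mono mult_right_mono) auto
    finally show ?thesis by (simp add: algebra_simps)
  qed
  have inb: "x + s *\<^sub>R v + s' *\<^sub>R w \<in> ball x r" if "0 \<le> s" "s \<le> t" "0 \<le> s'" "s' \<le> t" for s s'
  proof -
    have "dist x (x + s *\<^sub>R v + s' *\<^sub>R w) = norm (s *\<^sub>R v + s' *\<^sub>R w)"
      by (simp add: dist_norm norm_minus_commute add.assoc flip: minus_add_distrib)
    then show ?thesis using n[OF that] t(2) by simp
  qed
  have d1: "(f has_derivative D f y) (at y)" if "y \<in> ball x r" for y
    using Ck_on_has_derivative[OF f that] .
  have d2: "((\<lambda>y. D f y v) has_derivative D (\<lambda>y. D f y v) y) (at y)" if "y \<in> ball x r" for y
    using f that by (intro has_derivative_D) simp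
  have line: "((\<lambda>s. g (a + s *\<^sub>R b)) has_derivative (\<lambda>c. c * g' b)) (at s)"
    if "(g has_derivative g') (at (a + s *\<^sub>R b))" for g :: "'a \<Rightarrow> real" and g' a b s
  proof -
    have "((\<lambda>s. a + s *\<^sub>R b) has_derivative (\<lambda>c. c *\<^sub>R b)) (at s)"
      by (auto intro!: derivative_eq_intros)
    from diff_chain_at[OF this that] show ?thesis
      using linear_scale[OF has_derivative_linear[OF that]] by (simp add: o_def)
  qed
  \<comment> \<open>\<phi> is the difference along w as a function of the step s along v; its
    increment over [0, t] is the second difference. Below, \<psi> repeats this for the derivative
    along v.\<close>
  let ?\<phi> = "\<lambda>s. f (x + t *\<^sub>R w + s *\<^sub>R v) - f (x + s *\<^sub>R v)"
  let ?\<phi>' = "\<lambda>s c. c * D f (x + t *\<^sub>R w + s *\<^sub>R v) v - c * D f (x + s *\<^sub>R v) v"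
  have dphi: "(?\<phi> has_derivative ?\<phi>' s) (at s)" if "0 \<le> s" "s \<le> t" for s
    using inb[of s t] inb[of s 0] that t(1)
    by (intro has_derivative_diff line d1) (simp_all add: algebra_simps)
  obtain \<sigma> where \<sigma>: "\<sigma> \<in> {0<..<t}" "?\<phi> t - ?\<phi> 0 = ?\<phi>' \<sigma> (t - 0)"
    using mvt_simple[OF t(1), of ?\<phi> ?\<phi>'] dphi has_derivative_at_withinI
    by (metis (no_types, lifting) atLeastAtMost_iff)
  let ?\<psi> = "\<lambda>s. D f (x + \<sigma> *\<^sub>R v + s *\<^sub>R w) v"
  let ?\<psi>' = "\<lambda>s c. c * D (\<lambda>y. D f y v) (x + \<sigma> *\<^sub>R v + s *\<^sub>R w) w"
  have dpsi: "(?\<psi> has_derivative ?\<psi>' s) (at s)" if "0 \<le> s" "s \<le> t" for s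
    using inb[of \<sigma> s] that \<sigma>(1)
    by (intro line[where g = "\<lambda>y. D f y v"] d2) simp_all
  obtain \<tau> where \<tau>: "\<tau> \<in> {0<..<t}" "?\<psi> t - ?\<psi> 0 = ?\<psi>' \<tau> (t - 0)"
    using mvt_simple[OF t(1), of ?\<psi> ?\<psi>'] dpsi has_derivative_at_withinI
    by (metis (no_types, lifting) atLeastAtMost_iff)
  let ?\<xi> = "x + \<sigma> *\<^sub>R v + \<tau> *\<^sub>R w"
  have "f (x + t *\<^sub>R v + t *\<^sub>R w) - f (x + t *\<^sub>R v) - f (x + t *\<^sub>R w) + f x = ?\<phi> t - ?\<phi> 0"
    by (simp add: algebra_simps)
  also have "\<dots> = t * (?\<psi> t - ?\<psi> 0)"
    unfolding \<sigma>(2) by (simp add: algebra_simps)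
  also have "\<dots> = t * t * D (\<lambda>y. D f y v) ?\<xi> w" unfolding \<tau>(2) by simp
  finally have "f (x + t *\<^sub>R v + t *\<^sub>R w) - f (x + t *\<^sub>R v) - f (x + t *\<^sub>R w) + f x =
      t * t * D (\<lambda>y. D f y v) ?\<xi> w" .
  moreover have "norm (?\<xi> - x) \<le> t * (norm v + norm w)"
    using n[of \<sigma> \<tau>] \<sigma>(1) \<tau>(1) by (simp add: add.assoc)
  ultimately show ?thesis by blast
qed

text \<open>The second difference is symmetric in v and w. Divided by t^2 it converges to either
  mixed derivative, by continuity of the second derivatives at x.\<close>

lemma second_derivative_symmetric_real:
  fixes f :: "'a::real_normed_vector \<Rightarrow> real"
  assumes U: "open U" "x \<in> U" and f: "Ck_on (Suc (Suc 0)) U f"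
  shows "D (\<lambda>y. D f y v) x w = D (\<lambda>y. D f y w) x v"
proof -
  obtain r where r: "r > 0" "ball x r \<subseteq> U" using U openE by blast
  have fr: "Ck_on (Suc (Suc 0)) (ball x r) f" using Ck_on_subset[OF f r(2)] .
  \<comment> \<open>The summand 1 keeps M positive when v = w = 0 and makes t n * (norm v + norm w)
    strictly smaller than r.\<close>
  define M where "M = norm v + norm w + 1"
  have M: "M > 0" "norm v + norm w < M" by (simp_all add: M_def add_nonneg_pos)
  define t where "t n = r / M / real (Suc n)" for n
  have tpos: "t n > 0" for n using r(1) M(1) by (simp add: t_def)
  have tr: "t n * (norm v + norm w) < r" for n
  proof -
    have "t n * (norm v + norm w) < t n * M" using M(2) tpos by simp
    also have "\<dots> = r / real (Suc n)" using M(1) by (simp add: t_def)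
    also have "\<dots> \<le> r" using r(1) by (simp add: field_simps)
    finally show ?thesis .
  qed
  have tlim: "(\<lambda>n. t n * c) \<longlonglongrightarrow> 0" for c
    using tendsto_mult_left[OF LIMSEQ_inverse_real_of_nat, of "r / M * c"]
    by (simp add: t_def divide_inverse mult_ac)
  have key: "\<exists>\<xi>. norm (\<xi> - x) \<le> t n * (norm a + norm b) \<and>
      f (x + t n *\<^sub>R a + t n *\<^sub>R b) - f (x + t n *\<^sub>R a) - f (x + t n *\<^sub>R b) + f x =
      t n * t n * D (\<lambda>y. D f y a) \<xi> b" if "norm a + norm b = norm v + norm w" for a b n
    by (rule mixed_difference_quotient[OF fr tpos]) (use tr that in simp)
  have lim: "(\<lambda>n. (f (x + t n *\<^sub>R a + t n *\<^sub>R b) - f (x + t n *\<^sub>R a) - f (x + t n *\<^sub>R b) + f x) / (t n * t n))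
      \<longlonglongrightarrow> D (\<lambda>y. D f y a) x b" if ab: "norm a + norm b = norm v + norm w" for a b
  proof -
    obtain \<xi> where \<xi>: "\<And>n. norm (\<xi> n - x) \<le> t n * (norm a + norm b)"
      "\<And>n. f (x + t n *\<^sub>R a + t n *\<^sub>R b) - f (x + t n *\<^sub>R a) - f (x + t n *\<^sub>R b) + f x =
        t n * t n * D (\<lambda>y. D f y a) (\<xi> n) b"
      using key[OF ab] by metis
    have "(\<lambda>n. \<xi> n - x) \<longlonglongrightarrow> 0"
      by (rule Lim_null_comparison[OF _ tlim[of "norm a + norm b"]]) (use \<xi>(1) in simp)
    then have "\<xi> \<longlonglongrightarrow> x" by (simp add: LIM_zero_iff)
    moreover have "isCont (\<lambda>y. D (\<lambda>y. D f y a) y b) x"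
      using f U by (simp add: continuous_on_eq_continuous_at)
    ultimately have "(\<lambda>n. D (\<lambda>y. D f y a) (\<xi> n) b) \<longlonglongrightarrow> D (\<lambda>y. D f y a) x b"
      by (rule isCont_tendsto_compose[rotated])
    moreover have "(f (x + t n *\<^sub>R a + t n *\<^sub>R b) - f (x + t n *\<^sub>R a) - f (x + t n *\<^sub>R b) + f x) / (t n * t n)
        = D (\<lambda>y. D f y a) (\<xi> n) b" for n
      unfolding \<xi>(2) using tpos[of n] by simp
    ultimately show ?thesis by simp
  qed
  have swap: "(f (x + t n *\<^sub>R w + t n *\<^sub>R v) - f (x + t n *\<^sub>R w) - f (x + t n *\<^sub>R v) + f x) =
     (f (x + t n *\<^sub>R v + t n *\<^sub>R w) - f (x + t n *\<^sub>R v) - f (x + t n *\<^sub>R w) + f x)" for n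
    by (simp add: add_ac)
  show ?thesis
    using LIMSEQ_unique[OF lim[of v w] lim[of w v, unfolded swap]] by simp
qed

text \<open>Reduction to real functions by pairing f with every fixed vector b.\<close>

lemma second_derivative_symmetric:
  fixes f :: "'a::real_normed_vector \<Rightarrow> 'b::real_inner"
  assumes U: "open U" "x \<in> U" and f: "Ck_on (Suc (Suc 0)) U f"
  shows "D (\<lambda>y. D f y v) x w = D (\<lambda>y. D f y w) x v"
proof -
  have D1: "D (\<lambda>y. inner (f y) b) y a = inner (D f y a) b" if "y \<in> U" for y a b
    using D_eq[OF has_derivative_inner_left[OF Ck_on_has_derivative[OF f that]]] by simp
  have D2: "D (\<lambda>y. D (\<lambda>y. inner (f y) b) y a) x c = inner (D (\<lambda>y. D f y a) x c) b" for a b c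
  proof -
    have d: "(\<lambda>y. D f y a) differentiable (at x)" using f U(2) by simp
    have "((\<lambda>y. inner (D f y a) b) has_derivative (\<lambda>c. inner (D (\<lambda>y. D f y a) x c) b)) (at x)"
      by (rule has_derivative_inner_left[OF has_derivative_D[OF d]])
    then have "((\<lambda>y. D (\<lambda>y. inner (f y) b) y a) has_derivative
        (\<lambda>c. inner (D (\<lambda>y. D f y a) x c) b)) (at x)"
      by (rule has_derivative_transform_within_open[OF _ U]) (simp add: D1)
    from D_eq[OF this] show ?thesis by simp
  qed
  have "Ck_on (Suc (Suc 0)) U (\<lambda>y. inner (f y) b)" for b
    by (rule Ck_on_bounded_linear[OF U(1) bounded_linear_inner_left f])
  from second_derivative_symmetric_real[OF U this]
  have "inner (D (\<lambda>y. D f y v) x w) b = inner (D (\<lambda>y. D f y w) x v) b" for b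
    unfolding D2 .
  then show ?thesis by (metis inner_commute vector_eq_rdot)
qed

lemma smooth_on_SucD: "smooth_on U f \<Longrightarrow> Ck_on (Suc k) U f"
  by (simp add: smooth_on_def del: Ck_on.simps)

lemma smooth_on_differentiable: "smooth_on U f \<Longrightarrow> x \<in> U \<Longrightarrow> f differentiable (at x)"
  using smooth_on_SucD[of U f 0] by simp

lemma smooth_on_D: "smooth_on U f \<Longrightarrow> smooth_on U (\<lambda>x. D f x v)"
  unfolding smooth_on_def[of U "\<lambda>x. D f x v"] using smooth_on_SucD[of U f] by simp

lemma smooth_on_subset: "smooth_on U f \<Longrightarrow> V \<subseteq> U \<Longrightarrow> smooth_on V f"
  unfolding smooth_on_def using Ck_on_subset by blast

lemma smooth_on_cong:
  assumes "open U" "smooth_on U f" "\<And>x. x \<in> U \<Longrightarrow> f x = g x"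
  shows "smooth_on U g"
  unfolding smooth_on_def
proof
  fix k
  have "Ck_on k U f" using assms(2) by (simp add: smooth_on_def)
  from Ck_on_cong[OF assms(1) this assms(3)] show "Ck_on k U g" .
qed

lemma smooth_on_local:
  assumes "\<And>x. x \<in> U \<Longrightarrow> \<exists>V. open V \<and> x \<in> V \<and> smooth_on V f"
  shows "smooth_on U f"
  unfolding smooth_on_def
proof
  fix k
  show "Ck_on k U f"
    by (rule Ck_on_local) (use assms in \<open>unfold smooth_on_def, blast\<close>)
qed

lemma smooth_on_compose:
  fixes f :: "'a::real_normed_vector \<Rightarrow> 'b::real_inner"
  assumes "\<exists>B::'b set. orthonormal_basis B" "open U" "f ` U \<subseteq> V" "smooth_on U f" "smooth_on V g"
  shows "smooth_on U (\<lambda>x. g (f x))"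
  unfolding smooth_on_def
proof
  fix k
  have "Ck_on k U f" "Ck_on k V g" using assms(4,5) by (simp_all add: smooth_on_def)
  from Ck_on_compose[OF assms(1-3) this] show "Ck_on k U (\<lambda>x. g (f x))" .
qed

lemma smooth_on_affine:
  assumes "open U" "bounded_linear L"
  shows "smooth_on U (\<lambda>x. a + L x)"
proof -
  have "Ck_on k U (\<lambda>x. x)" for k
  proof (cases k)
    case (Suc n)
    show ?thesis unfolding Suc
      by (rule Ck_on_SucI[where f' = "\<lambda>_ v. v", OF assms(1) has_derivative_ident]) (rule Ck_on_const)
  qed (simp add: continuous_on_id)
  from Ck_on_add[OF assms(1) Ck_on_const Ck_on_bounded_linear[OF assms this]]
  show ?thesis unfolding smooth_on_def by blast
qed

section \<open>Smooth maps in charts\<close>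

text \<open>Trivializations take values in M x G, whose charts map to the product of the two model
  spaces.\<close>

lemma orthonormal_basis_prod:
  assumes "\<exists>B::'a::real_inner set. orthonormal_basis B" "\<exists>B::'b::real_inner set. orthonormal_basis B"
  shows "\<exists>B::('a \<times> 'b) set. orthonormal_basis B"
proof -
  obtain B :: "'a set" and C :: "'b set" where
    B: "finite B" "span B = UNIV" and C: "finite C" "span C = UNIV"
    using assms unfolding orthonormal_basis_def by blast
  let ?l = "\<lambda>x. (x, 0) :: 'a \<times> 'b" and ?r = "\<lambda>y. (0, y) :: 'a \<times> 'b"
  let ?D = "?l ` B \<union> ?r ` C"
  have lr: "linear ?l" "linear ?r" by (auto intro!: linearI)
  have "range ?l \<subseteq> span ?D" "range ?r \<subseteq> span ?D"
    using linear_span_image[OF lr(1), of B] linear_span_image[OF lr(2), of C] B C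
      span_mono[of "?l ` B" ?D] span_mono[of "?r ` C" ?D] by auto
  then have "?l x + ?r y \<in> span ?D" for x y by (intro span_add) auto
  then have "span ?D = UNIV" by auto
  moreover have "finite ?D" using B C by simp
  ultimately show ?thesis by (intro orthonormal_basis_exists exI[of _ ?D] conjI)
qed

lemma chart_inv_left: "is_chart c \<Longrightarrow> p \<in> fst c \<Longrightarrow> chart_inv c (snd c p) = p"
  unfolding is_chart_def by (auto simp: homeomorphism_def)

lemma chart_inv_right: "x \<in> snd c ` fst c \<Longrightarrow> snd c (chart_inv c x) = x"
  by (rule f_inv_into_f)

lemma chart_inv_in: "x \<in> snd c ` fst c \<Longrightarrow> chart_inv c x \<in> fst c"
  by (rule inv_into_into)

lemma chart_open: "is_chart c \<Longrightarrow> open (fst c)" "is_chart c \<Longrightarrow> open (snd c ` fst c)"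
  by (auto simp: is_chart_def)

lemma chart_continuous: "is_chart c \<Longrightarrow> continuous_on (fst c) (snd c)"
  "is_chart c \<Longrightarrow> continuous_on (snd c ` fst c) (chart_inv c)"
  by (auto simp: is_chart_def homeomorphism_def)

lemma chart_image_open:
  assumes c: "is_chart c" and W: "open W" "W \<subseteq> fst c"
  shows "open (snd c ` W)"
proof -
  have "snd c ` W = snd c ` fst c \<inter> chart_inv c -` W"
  proof (intro equalityI subsetI)
    fix x assume "x \<in> snd c ` W"
    then show "x \<in> snd c ` fst c \<inter> chart_inv c -` W"
      using W(2) chart_inv_left[OF c] by auto
  next
    fix x assume x: "x \<in> snd c ` fst c \<inter> chart_inv c -` W"
    then have "x = snd c (chart_inv c x)" using chart_inv_right[of x c] by simp
    then show "x \<in> snd c ` W" using x by blast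
  qed
  then show ?thesis
    using continuous_open_preimage[OF chart_continuous(2)[OF c] chart_open(2)[OF c] W(1)] by simp
qed

lemma smooth_atlasD:
  assumes "smooth_atlas (A :: ('m::topological_space, 'e::real_inner) chart set)"
  shows "\<exists>B::'e set. orthonormal_basis B" and "c \<in> A \<Longrightarrow> is_chart c"
    and "\<exists>c\<in>A. p \<in> fst c"
  using assms orthonormal_basis_exists unfolding smooth_atlas_def by blast+

lemma chart_at:
  assumes "smooth_atlas A"
  shows "chart_at A p \<in> A" "p \<in> fst (chart_at A p)"
proof -
  have "\<exists>c. c \<in> A \<and> p \<in> fst c" using smooth_atlasD(3)[OF assms] by blast
  from someI_ex[OF this] show "chart_at A p \<in> A" "p \<in> fst (chart_at A p)"
    unfolding chart_at_def by blast+
qed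

text \<open>Near each point the composite factors through a chart of B around the image point. Of C
  only open chart domains are asked, so \<open>line_atlas\<close> qualifies as a target.\<close>

lemma smooth_map_on_compose:
  assumes A: "\<And>c. c \<in> A \<Longrightarrow> is_chart c" and B: "smooth_atlas B"
    and C: "\<And>e. e \<in> C \<Longrightarrow> open (fst e)"
    and W: "open W" and V: "open V" and FW: "F ` W \<subseteq> V"
    and F: "smooth_map_on W A B F" and G: "smooth_map_on V B C G"
  shows "smooth_map_on W A C (\<lambda>x. G (F x))"
  unfolding smooth_map_on_def
proof (intro conjI ballI)
  have cF: "continuous_on W F" and cG: "continuous_on V G"
    using F G by (auto simp: smooth_map_on_def)
  show "continuous_on W (\<lambda>x. G (F x))"
    by (rule continuous_on_compose2[OF cG cF FW])
  fix c e assume c: "c \<in> A" and e: "e \<in> C"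
  note cc = A[OF c]
  show "smooth_on (snd c ` (fst c \<inter> W \<inter> (\<lambda>x. G (F x)) -` fst e)) (snd e \<circ> (\<lambda>x. G (F x)) \<circ> chart_inv c)"
  proof (rule smooth_on_local)
    fix x assume "x \<in> snd c ` (fst c \<inter> W \<inter> (\<lambda>x. G (F x)) -` fst e)"
    then obtain p where p: "x = snd c p" "p \<in> fst c" "p \<in> W" "G (F p) \<in> fst e" by auto
    obtain d where d: "d \<in> B" "F p \<in> fst d" using smooth_atlasD(3)[OF B] by blast
    note dd = smooth_atlasD(2)[OF B d(1)]
    define Q where "Q = fst d \<inter> V \<inter> G -` fst e"
    have "open (V \<inter> G -` fst e)" by (rule continuous_open_preimage[OF cG V C[OF e]])
    then have "open Q" unfolding Q_def using chart_open(1)[OF dd] by (metis Int_assoc open_Int)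
    then have "open (W \<inter> F -` Q)" by (rule continuous_open_preimage[OF cF W])
    then have "open (fst c \<inter> (W \<inter> F -` Q))" using chart_open(1)[OF cc] by blast
    then have oN: "open (snd c ` (fst c \<inter> (W \<inter> F -` Q)))" (is "open ?N")
      by (rule chart_image_open[OF cc]) blast
    have xN: "x \<in> ?N" using p d FW by (auto simp: Q_def)
    let ?f = "snd d \<circ> F \<circ> chart_inv c" and ?g = "snd e \<circ> G \<circ> chart_inv d"
    have sf: "smooth_on ?N ?f"
      by (rule smooth_on_subset[of "snd c ` (fst c \<inter> W \<inter> F -` fst d)"])
        (use F c d(1) in \<open>auto simp: smooth_map_on_def Q_def\<close>)
    have sg: "smooth_on (snd d ` Q) ?g"
      using G d(1) e by (simp add: smooth_map_on_def Q_def)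
    have im: "?f ` ?N \<subseteq> snd d ` Q"
      using chart_inv_left[OF cc] by auto
    have "smooth_on ?N (\<lambda>y. ?g (?f y))"
      by (rule smooth_on_compose[OF smooth_atlasD(1)[OF B] oN im sf sg])
    then have "smooth_on ?N (snd e \<circ> (\<lambda>x. G (F x)) \<circ> chart_inv c)"
      by (rule smooth_on_cong[OF oN])
        (use chart_inv_left[OF cc] chart_inv_left[OF dd] in \<open>auto simp: Q_def\<close>)
    then show "\<exists>V. open V \<and> x \<in> V \<and> smooth_on V (snd e \<circ> (\<lambda>x. G (F x)) \<circ> chart_inv c)"
      using oN xN by blast
  qed
qed

lemma smooth_map_local:
  assumes A: "\<And>c. c \<in> A \<Longrightarrow> is_chart c" and B: "\<And>d. d \<in> B \<Longrightarrow> open (fst d)"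
    and loc: "\<And>x. \<exists>U. open U \<and> x \<in> U \<and> smooth_map_on U A B F"
  shows "smooth_map A B F"
  unfolding smooth_map_on_def
proof (intro conjI ballI)
  let ?S = "{U. open U \<and> smooth_map_on U A B F}"
  have "continuous_on (\<Union>?S) F"
    by (rule continuous_on_open_Union) (auto simp: smooth_map_on_def)
  moreover have "\<Union>?S = UNIV" using loc by blast
  ultimately show cF: "continuous_on UNIV F" by simp
  fix c d assume c: "c \<in> A" and d: "d \<in> B"
  show "smooth_on (snd c ` (fst c \<inter> UNIV \<inter> F -` fst d)) (snd d \<circ> F \<circ> chart_inv c)"
  proof (rule smooth_on_local)
    fix x assume "x \<in> snd c ` (fst c \<inter> UNIV \<inter> F -` fst d)"
    then obtain p where p: "x = snd c p" "p \<in> fst c" "F p \<in> fst d" by auto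
    obtain U where U: "open U" "p \<in> U" "smooth_map_on U A B F" using loc by blast
    have "open (U \<inter> F -` fst d)"
      by (rule continuous_open_preimage[OF _ U(1) B[OF d]]) (use U(3) in \<open>simp add: smooth_map_on_def\<close>)
    then have "open (fst c \<inter> U \<inter> F -` fst d)"
      using chart_open(1)[OF A[OF c]] by (metis Int_assoc open_Int)
    then have "open (snd c ` (fst c \<inter> U \<inter> F -` fst d))"
      by (rule chart_image_open[OF A[OF c]]) blast
    moreover have "smooth_on (snd c ` (fst c \<inter> U \<inter> F -` fst d)) (snd d \<circ> F \<circ> chart_inv c)"
      using U(3) c d by (simp add: smooth_map_on_def)
    moreover have "x \<in> snd c ` (fst c \<inter> U \<inter> F -` fst d)" using p U(2) by blast
    ultimately show "\<exists>V. open V \<and> x \<in> V \<and> smooth_on V (snd d \<circ> F \<circ> chart_inv c)" by blast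
  qed
qed

lemma smooth_map_on_cong:
  assumes A: "\<And>c. c \<in> A \<Longrightarrow> is_chart c" and B: "\<And>d. d \<in> B \<Longrightarrow> open (fst d)"
    and U: "open U" and F: "smooth_map_on U A B F" and eq: "\<And>x. x \<in> U \<Longrightarrow> F x = G x"
  shows "smooth_map_on U A B G"
  unfolding smooth_map_on_def
proof (intro conjI ballI)
  have cF: "continuous_on U F" using F by (simp add: smooth_map_on_def)
  then show "continuous_on U G" using eq by (simp cong: continuous_on_cong)
  fix c d assume c: "c \<in> A" and d: "d \<in> B"
  have "open (fst c \<inter> (U \<inter> F -` fst d))"
    using chart_open(1)[OF A[OF c]] continuous_open_preimage[OF cF U B[OF d]] by blast
  then have o: "open (snd c ` (fst c \<inter> (U \<inter> F -` fst d)))"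
    by (rule chart_image_open[OF A[OF c]]) blast
  have dom: "fst c \<inter> U \<inter> G -` fst d = fst c \<inter> (U \<inter> F -` fst d)" using eq by auto
  have "smooth_on (snd c ` (fst c \<inter> (U \<inter> F -` fst d))) (snd d \<circ> F \<circ> chart_inv c)"
    using F c d by (simp add: smooth_map_on_def Int_assoc)
  then show "smooth_on (snd c ` (fst c \<inter> U \<inter> G -` fst d)) (snd d \<circ> G \<circ> chart_inv c)"
    unfolding dom
    by (rule smooth_on_cong[OF o]) (use eq chart_inv_left[OF A[OF c]] in auto)
qed

section \<open>Product charts and local sections\<close>

lemma chart_inv_prod:
  assumes "is_chart c" "is_chart d" "p \<in> fst c" "q \<in> fst d"
  shows "inv_into (fst c \<times> fst d) (map_prod (snd c) (snd d)) (snd c p, snd d q) = (p, q)"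
proof -
  have "inj_on (snd c) (fst c)" "inj_on (snd d) (fst d)"
    using chart_inv_left assms(1,2) by (metis inj_onI)+
  then have "inj_on (map_prod (snd c) (snd d)) (fst c \<times> fst d)"
    by (auto simp: inj_on_def)
  from inv_into_f_f[OF this, of "(p, q)"] assms(3,4) show ?thesis by simp
qed

lemma prod_chart_image_open:
  assumes c: "is_chart c" and d: "is_chart d" and N: "open N" "N \<subseteq> fst c \<times> fst d"
  shows "open (map_prod (snd c) (snd d) ` N)"
proof -
  let ?T = "(snd c ` fst c) \<times> (snd d ` fst d)" and ?g = "\<lambda>w. (chart_inv c (fst w), chart_inv d (snd w))"
  have cont: "continuous_on ?T ?g"
    by (intro continuous_on_Pair continuous_on_compose2[OF chart_continuous(2)[OF c]]
        continuous_on_compose2[OF chart_continuous(2)[OF d]] continuous_intros) auto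
  have "map_prod (snd c) (snd d) ` N = ?T \<inter> ?g -` N"
  proof (intro equalityI subsetI)
    fix w assume "w \<in> map_prod (snd c) (snd d) ` N"
    then show "w \<in> ?T \<inter> ?g -` N"
      using N(2) chart_inv_left[OF c] chart_inv_left[OF d] by force
  next
    fix w assume w: "w \<in> ?T \<inter> ?g -` N"
    then have "w = map_prod (snd c) (snd d) (?g w)"
      using chart_inv_right[of "fst w" c] chart_inv_right[of "snd w" d]
      by (auto simp: prod_eq_iff mem_Times_iff)
    then show "w \<in> map_prod (snd c) (snd d) ` N" using w by blast
  qed
  then show ?thesis
    using continuous_open_preimage[OF cont open_Times[OF chart_open(2)[OF c] chart_open(2)[OF d]] N(1)]
    by simp
qed

text \<open>Holding the group coordinate of a trivialization fixed gives a local section of the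
  bundle; through it, smoothness on P will descend to the base.\<close>

lemma smooth_section:
  fixes AM :: "('m::topological_space, 'f::real_inner) chart set"
    and AG :: "('g::topological_space, 'l::real_inner) chart set"
  assumes AM: "smooth_atlas AM" and AG: "smooth_atlas AG" and AP: "smooth_atlas AP"
    and triv: "local_trivialization G AG AP AM act \<pi> U \<Phi>"
  shows "smooth_map_on U AM AP (\<lambda>y. inv_into (\<pi> -` U) \<Phi> (y, g))"
  unfolding smooth_map_on_def
proof (intro conjI ballI)
  let ?\<Psi> = "inv_into (\<pi> -` U) \<Phi>" and ?s = "\<lambda>y. inv_into (\<pi> -` U) \<Phi> (y, g)"
  have U: "open U" and \<Psi>: "smooth_map_on (U \<times> UNIV) (prod_atlas AM AG) AP ?\<Psi>"
    using triv by (auto simp: local_trivialization_def)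
  have c\<Psi>: "continuous_on (U \<times> UNIV) ?\<Psi>" using \<Psi> by (simp add: smooth_map_on_def)
  show cs: "continuous_on U ?s"
    by (rule continuous_on_compose2[OF c\<Psi>]) (auto intro!: continuous_intros)
  fix d c assume d: "d \<in> AM" and c: "c \<in> AP"
  obtain a where a: "a \<in> AG" "g \<in> fst a" using smooth_atlasD(3)[OF AG] by blast
  note dd = smooth_atlasD(2)[OF AM d] and aa = smooth_atlasD(2)[OF AG a(1)]
  let ?e = "(fst d \<times> fst a, map_prod (snd d) (snd a))"
  have e: "?e \<in> prod_atlas AM AG"
    unfolding prod_atlas_def by (intro CollectI exI[of _ d] exI[of _ a]) (simp add: d a(1))
  let ?N = "snd d ` (fst d \<inter> U \<inter> ?s -` fst c)"
  have "open (U \<inter> ?s -` fst c)"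
    by (rule continuous_open_preimage[OF cs U chart_open(1)[OF smooth_atlasD(2)[OF AP c]]])
  then have "open (fst d \<inter> U \<inter> ?s -` fst c)"
    using chart_open(1)[OF dd] by (metis Int_assoc open_Int)
  then have oN: "open ?N" by (rule chart_image_open[OF dd]) blast
  \<comment> \<open>In the charts d and d x a, the map sending y to (y, g) is an affine inclusion of
    a slice.\<close>
  have "bounded_linear (\<lambda>x::'f. (x, 0::'l))"
    by (rule bounded_linear_Pair[OF bounded_linear_ident bounded_linear_zero])
  from smooth_on_affine[OF oN this, of "(0, snd a g)"]
  have sl: "smooth_on ?N (\<lambda>x. (x, snd a g))" by simp
  let ?O = "snd ?e ` (fst ?e \<inter> U \<times> UNIV \<inter> ?\<Psi> -` fst c)"
  have sg: "smooth_on ?O (snd c \<circ> ?\<Psi> \<circ> chart_inv ?e)"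
    using \<Psi> e c unfolding smooth_map_on_def by blast
  have im: "(\<lambda>x. (x, snd a g)) ` ?N \<subseteq> ?O"
    using a(2) by (auto intro!: image_eqI[of _ _ "(_, g)"])
  have "smooth_on ?N (\<lambda>x. (snd c \<circ> ?\<Psi> \<circ> chart_inv ?e) (x, snd a g))"
    by (rule smooth_on_compose[OF orthonormal_basis_prod[OF smooth_atlasD(1)[OF AM] smooth_atlasD(1)[OF AG]]
          oN im sl sg])
  then show "smooth_on ?N (snd c \<circ> ?s \<circ> chart_inv d)"
    by (rule smooth_on_cong[OF oN]) (use chart_inv_prod[OF dd aa _ a(2)] chart_inv_left[OF dd] in auto)
qed

lemma riemannian_metric_on:
  assumes A: "smooth_atlas A" and g: "riemannian_metric A g" and c: "c \<in> A"
    and U: "open U" "U \<subseteq> snd c ` fst c"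
  shows "metric_on U (local_metric g c)"
  unfolding metric_on_def
proof (intro conjI ballI allI impI)
  fix x v w assume x: "x \<in> U"
  then have "chart_inv c x \<in> fst c" using U(2) chart_inv_in[of x c] by blast
  then show "bilinear (local_metric g c x)" "local_metric g c x v w = local_metric g c x w v"
    "v \<noteq> 0 \<Longrightarrow> local_metric g c x v v > 0"
    using g c unfolding riemannian_metric_def local_metric_def by blast+
  show "(\<lambda>y. local_metric g c y v w) differentiable (at x)"
    by (rule smooth_on_differentiable[of "snd c ` fst c"])
      (use g c U(2) x in \<open>auto simp: riemannian_metric_def\<close>)
qed (use U in auto)

text \<open>Locality of the Laplacian. It joins two coordinate expressions of the pulled-back
  function, \<open>u \<circ> F\<close> and \<open>\<phi> \<circ> \<pi> \<circ> chart_inv c\<close>,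
  whose agreement is known on U.\<close>

lemma divergence_gradient_cong:
  fixes h :: "'e::real_inner \<Rightarrow> 'e \<Rightarrow> 'e \<Rightarrow> real"
  assumes fd: "\<exists>B::'e set. orthonormal_basis B" and h: "metric_on U h" and x: "x \<in> U"
    and f: "smooth_on U f" and eq: "\<And>y. y \<in> U \<Longrightarrow> f y = f' y"
  shows "divergence h (gradient h f) x = divergence h (gradient h f') x"
proof -
  note d = smooth_on_differentiable[OF f]
  have "D f y = D f' y" if "y \<in> U" for y
    by (rule D_cong_open[OF d[OF that] metric_onD(1)[OF h] that eq])
  then have g: "gradient h f y = gradient h f' y" if "y \<in> U" for y
    using that by (simp add: gradient_def)
  have "gradient h f differentiable (at x)"
    by (rule gradient_differentiable[OF fd h x d smooth_on_differentiable[OF smooth_on_D[OF f] x]])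
  from D_cong_open[OF this metric_onD(1)[OF h] x g] g[OF x] show ?thesis
    by (simp add: divergence_def covariant_derivative_def)
qed

section \<open>Pull-back along principal bundles\<close>

text \<open>\<open>tangent_to\<close> asks for smoothness in every chart; a curve given in one chart
  obtains it from the transition maps.\<close>

lemma smooth_curve_in_chart:
  assumes A: "smooth_atlas A" and c: "c \<in> A" and I: "open I"
    and \<gamma>: "smooth_on I \<gamma>" "\<gamma> ` I \<subseteq> snd c ` fst c"
  shows "smooth_map_on I line_atlas A (\<lambda>t. chart_inv c (\<gamma> t))"
  unfolding smooth_map_on_def
proof (intro conjI ballI)
  note cc = smooth_atlasD(2)[OF A c]
  have c\<gamma>: "continuous_on I \<gamma>"
    using Ck_on_continuous \<gamma>(1) unfolding smooth_on_def by blast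
  show cs: "continuous_on I (\<lambda>t. chart_inv c (\<gamma> t))"
    by (rule continuous_on_compose2[OF chart_continuous(2)[OF cc] c\<gamma> \<gamma>(2)])
  fix l d assume l: "l \<in> line_atlas" and d: "d \<in> A"
  let ?N = "I \<inter> (\<lambda>t. chart_inv c (\<gamma> t)) -` fst d"
  have oN: "open ?N"
    by (rule continuous_open_preimage[OF cs I chart_open(1)[OF smooth_atlasD(2)[OF A d]]])
  have tr: "smooth_on (snd c ` (fst c \<inter> fst d)) (snd d \<circ> chart_inv c)"
    using A c d by (simp add: smooth_atlas_def)
  have im: "\<gamma> ` ?N \<subseteq> snd c ` (fst c \<inter> fst d)"
  proof
    fix y assume "y \<in> \<gamma> ` ?N"
    then obtain t where t: "t \<in> I" "chart_inv c (\<gamma> t) \<in> fst d" "y = \<gamma> t" by auto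
    have "\<gamma> t \<in> snd c ` fst c" using t(1) \<gamma>(2) by blast
    from chart_inv_right[OF this] chart_inv_in[OF this] t
    show "y \<in> snd c ` (fst c \<inter> fst d)" by (metis IntI image_eqI)
  qed
  have "smooth_on ?N (\<lambda>t. (snd d \<circ> chart_inv c) (\<gamma> t))"
    by (rule smooth_on_compose[OF smooth_atlasD(1)[OF A] oN im smooth_on_subset[OF \<gamma>(1)] tr]) blast
  then show "smooth_on (snd l ` (fst l \<inter> I \<inter> (\<lambda>t. chart_inv c (\<gamma> t)) -` fst d))
      (snd d \<circ> (\<lambda>t. chart_inv c (\<gamma> t)) \<circ> chart_inv l)"
    using l by (simp add: line_atlas_def o_def inv_id)
qed

lemma smooth_map_coordinates:
  assumes A: "smooth_atlas A" and B: "smooth_atlas B" and F: "smooth_map A B F"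
    and c: "c \<in> A" and d: "d \<in> B"
  shows "open (snd c ` (fst c \<inter> F -` fst d))"
    and "smooth_on (snd c ` (fst c \<inter> F -` fst d)) (snd d \<circ> F \<circ> chart_inv c)"
proof -
  have "continuous_on UNIV F" using F by (simp add: smooth_map_on_def)
  then have "open (F -` fst d)"
    using chart_open(1)[OF smooth_atlasD(2)[OF B d]] by (simp add: open_vimage)
  then have "open (fst c \<inter> F -` fst d)" using chart_open(1)[OF smooth_atlasD(2)[OF A c]] by blast
  then show "open (snd c ` (fst c \<inter> F -` fst d))"
    by (rule chart_image_open[OF smooth_atlasD(2)[OF A c]]) blast
  show "smooth_on (snd c ` (fst c \<inter> F -` fst d)) (snd d \<circ> F \<circ> chart_inv c)"
    using F c d by (simp add: smooth_map_on_def)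
qed

text \<open>\<pi> is constant along a curve in S, so the chain rule kills its velocity. This turns
  the conclusion of \<open>totally_geodesic\<close> into the statement that the covariant derivative
  is vertical.\<close>

lemma tangent_to_fibre:
  assumes A: "smooth_atlas A" and c: "c \<in> A" and p: "p \<in> fst c"
    and v: "tangent_to A S c p v" and S: "\<And>q. q \<in> S \<Longrightarrow> \<pi> q = \<pi> p"
    and F: "(snd d \<circ> \<pi> \<circ> chart_inv c) differentiable (at (snd c p))"
  shows "D (snd d \<circ> \<pi> \<circ> chart_inv c) (snd c p) v = 0"
proof -
  let ?F = "snd d \<circ> \<pi> \<circ> chart_inv c"
  note cc = smooth_atlasD(2)[OF A c]
  obtain s \<epsilon> where s: "0 < \<epsilon>" "smooth_map_on {-\<epsilon><..<\<epsilon>} line_atlas A s" "s ` {-\<epsilon><..<\<epsilon>} \<subseteq> S" "s 0 = p"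
    "vector_derivative (snd c \<circ> s) (at 0) = v"
    using v unfolding tangent_to_def by blast
  let ?N = "{-\<epsilon><..<\<epsilon>} \<inter> s -` fst c"
  have oN: "open ?N"
    by (rule continuous_open_preimage[OF _ _ chart_open(1)[OF cc]])
      (use s(2) in \<open>auto simp: smooth_map_on_def\<close>)
  have N0: "0 \<in> ?N" using s(1,4) p by simp
  have "smooth_on ?N (snd c \<circ> s)"
    using s(2) c by (simp add: smooth_map_on_def line_atlas_def inv_id)
  then have d: "(snd c \<circ> s) differentiable (at 0)"
    using N0 by (rule smooth_on_differentiable)
  have v1: "v = D (snd c \<circ> s) 0 1"
    using frechet_derivative_eq_vector_derivative[OF d] s(5) by simp
  have "(?F has_derivative D ?F (snd c p)) (at ((snd c \<circ> s) 0))"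
    using has_derivative_D[OF F] s(4) by simp
  from diff_chain_at[OF has_derivative_D[OF d] this]
  have 1: "(?F \<circ> (snd c \<circ> s) has_derivative D ?F (snd c p) \<circ> D (snd c \<circ> s) 0) (at 0)" .
  have "(?F \<circ> (snd c \<circ> s) has_derivative (\<lambda>_. 0)) (at 0)"
  proof (rule has_derivative_transform_within_open[OF has_derivative_const oN N0])
    fix t assume t: "t \<in> ?N"
    then have "\<pi> (s t) = \<pi> p" using s(3) S by blast
    then show "snd d (\<pi> p) = (?F \<circ> (snd c \<circ> s)) t"
      using t chart_inv_left[OF cc] by simp
  qed
  from fun_cong[OF has_derivative_unique[OF 1 this], of 1] show ?thesis by (simp add: v1)
qed

text \<open>The field is a coordinate field of the trivialization with constant components, so that
  the curves required by \<open>tangent_to\<close> are coordinate lines.\<close>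
lemma vertical_field:
  fixes AM :: "('m::topological_space, 'f::real_inner) chart set"
    and AG :: "('g::topological_space, 'l::real_inner) chart set"
  assumes AG: "smooth_atlas AG" and AP: "smooth_atlas AP" and AM: "smooth_atlas AM"
    and c: "c \<in> AP" and d: "d \<in> AM" and p: "p \<in> fst c" and \<pi>: "smooth_map AP AM \<pi>"
    and triv: "local_trivialization G AG AP AM act \<pi> U \<Phi>" and pU: "\<pi> p \<in> U" and pd: "\<pi> p \<in> fst d"
    and z: "D (snd d \<circ> \<pi> \<circ> chart_inv c) (snd c p) z = 0"
    and S: "\<And>q. q \<in> S \<longleftrightarrow> \<pi> q = \<pi> p"
  shows "\<exists>Z W. open W \<and> snd c p \<in> W \<and> W \<subseteq> snd c ` (fst c \<inter> \<pi> -` fst d) \<and> smooth_on W Z \<and>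
    Z (snd c p) = z \<and> (\<forall>y\<in>W. D (snd d \<circ> \<pi> \<circ> chart_inv c) y (Z y) = 0) \<and>
    (\<forall>q\<in>S \<inter> fst c. snd c q \<in> W \<longrightarrow> tangent_to AP S c q (Z (snd c q)))"
proof -
  define F where "F = snd d \<circ> \<pi> \<circ> chart_inv c"
  define \<Psi> where "\<Psi> = inv_into (\<pi> -` U) \<Phi>"
  note cc = smooth_atlasD(2)[OF AP c] and dd = smooth_atlasD(2)[OF AM d]
  obtain a where a: "a \<in> AG" "snd (\<Phi> p) \<in> fst a" using smooth_atlasD(3)[OF AG] by blast
  note aa = smooth_atlasD(2)[OF AG a(1)]
  define e where "e = (fst d \<times> fst a, map_prod (snd d) (snd a))"
  have e: "e \<in> prod_atlas AM AG"
    unfolding prod_atlas_def e_def by (intro CollectI exI[of _ d] exI[of _ a]) (simp add: d a(1))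
  have e_inv: "chart_inv e (snd e w) = w" if "w \<in> fst e" for w
    using chart_inv_prod[OF dd aa, of "fst w" "snd w"] that by (cases w) (auto simp: e_def)
  have fde: "\<exists>B::('f \<times> 'l) set. orthonormal_basis B"
    by (rule orthonormal_basis_prod[OF smooth_atlasD(1)[OF AM] smooth_atlasD(1)[OF AG]])
  have U: "open U" and bij: "bij_betw \<Phi> (\<pi> -` U) (U \<times> UNIV)"
    and s\<Phi>: "smooth_map_on (\<pi> -` U) AP (prod_atlas AM AG) \<Phi>"
    and s\<Psi>: "smooth_map_on (U \<times> UNIV) (prod_atlas AM AG) AP \<Psi>"
    and fst\<Phi>: "\<And>q. \<pi> q \<in> U \<Longrightarrow> fst (\<Phi> q) = \<pi> q"
    using triv by (auto simp: local_trivialization_def \<Psi>_def)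
  have oU: "open (\<pi> -` U)" using \<pi> U by (simp add: smooth_map_on_def open_vimage)
  have \<Psi>\<Phi>: "\<Psi> (\<Phi> q) = q" if "\<pi> q \<in> U" for q
    unfolding \<Psi>_def using inv_into_f_f[OF bij_betw_imp_inj_on[OF bij]] that by simp
  have \<Phi>\<Psi>: "\<Phi> (\<Psi> w) = w" "\<pi> (\<Psi> w) \<in> U" if "w \<in> U \<times> UNIV" for w
    using bij_betw_inv_into_right[OF bij that] inv_into_into[of w \<Phi> "\<pi> -` U"] that
      bij_betw_imp_surj_on[OF bij] by (auto simp: \<Psi>_def)
  have \<pi>\<Psi>: "\<pi> (\<Psi> w) = fst w" if "w \<in> U \<times> UNIV" for w
    using fst\<Phi>[OF \<Phi>\<Psi>(2)[OF that]] \<Phi>\<Psi>(1)[OF that] by simp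
  \<comment> \<open>f and g are the trivialization and its inverse in coordinates. Between W and V
    they satisfy \<open>g (f y) = y\<close>, and F becomes the first projection.\<close>
  define T1 where "T1 = fst c \<inter> \<pi> -` U \<inter> \<Phi> -` fst e"
  define T2 where "T2 = fst e \<inter> U \<times> UNIV \<inter> \<Psi> -` fst c"
  define f where "f = snd e \<circ> \<Phi> \<circ> chart_inv c"
  define g where "g = snd c \<circ> \<Psi> \<circ> chart_inv e"
  define W where "W = snd c ` T1"
  define V where "V = snd e ` T2"
  have sf: "smooth_on W f" using s\<Phi> c e by (simp add: smooth_map_on_def W_def T1_def f_def)
  have sg: "smooth_on V g" using s\<Psi> c e by (simp add: smooth_map_on_def V_def T2_def g_def)
  have oe: "open (fst e)" using chart_open(1)[OF dd] chart_open(1)[OF aa] by (simp add: e_def open_Times)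
  have "open (\<pi> -` U \<inter> \<Phi> -` fst e)"
    by (rule continuous_open_preimage[OF _ oU oe]) (use s\<Phi> in \<open>simp add: smooth_map_on_def\<close>)
  then have "open (fst c \<inter> (\<pi> -` U \<inter> \<Phi> -` fst e))" using chart_open(1)[OF cc] by blast
  then have oW: "open W"
    unfolding W_def T1_def Int_assoc by (rule chart_image_open[OF cc]) blast
  have "open (U \<times> UNIV \<inter> \<Psi> -` fst c)"
    by (rule continuous_open_preimage[OF _ _ chart_open(1)[OF cc]])
      (use s\<Psi> U in \<open>auto simp: smooth_map_on_def open_Times\<close>)
  then have "open (fst e \<inter> (U \<times> UNIV \<inter> \<Psi> -` fst c))" using oe by blast
  then have "open (map_prod (snd d) (snd a) ` (fst e \<inter> (U \<times> UNIV \<inter> \<Psi> -` fst c)))"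
    by (rule prod_chart_image_open[OF dd aa]) (auto simp: e_def)
  then have oV: "open V" unfolding V_def T2_def Int_assoc by (simp add: e_def)
  have fc: "f (snd c q) = snd e (\<Phi> q)" if "q \<in> T1" for q
    using that chart_inv_left[OF cc] by (simp add: f_def T1_def)
  have ge: "g (snd e w) = snd c (\<Psi> w)" if "w \<in> T2" for w
    using that e_inv by (simp add: g_def T2_def)
  have T12: "\<Phi> q \<in> T2" if q: "q \<in> T1" for q
  proof -
    have "\<pi> q \<in> U" using q by (simp add: T1_def)
    then have "\<Phi> q \<in> U \<times> UNIV" using bij_betwE[OF bij] by simp
    then show ?thesis using q \<Psi>\<Phi>[OF \<open>\<pi> q \<in> U\<close>] by (simp add: T1_def T2_def)
  qed
  have fV: "f ` W \<subseteq> V" using fc T12 by (auto simp: W_def V_def)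
  have gf: "g (f y) = y" if "y \<in> W" for y
  proof -
    obtain q where q: "y = snd c q" "q \<in> T1" using \<open>y \<in> W\<close> by (auto simp: W_def)
    then have "g (f y) = snd c (\<Psi> (\<Phi> q))" using fc ge T12 by simp
    then show ?thesis using \<Psi>\<Phi>[of q] q by (simp add: T1_def)
  qed
  have gV: "g w \<in> snd c ` fst c" if "w \<in> V" for w
    using that ge by (auto simp: V_def T2_def)
  have Fg: "F (g w) = fst w" and \<pi>g: "\<pi> (chart_inv c (g w)) \<in> fst d" if "w \<in> V" for w
  proof -
    obtain w' where w': "w = snd e w'" "w' \<in> T2" using \<open>w \<in> V\<close> unfolding V_def by blast
    have "chart_inv c (g w) = \<Psi> w'" using w' ge chart_inv_left[OF cc] by (auto simp: T2_def)
    moreover have "\<pi> (\<Psi> w') = fst w'" using \<pi>\<Psi> w'(2) by (auto simp: T2_def)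
    ultimately show "F (g w) = fst w" "\<pi> (chart_inv c (g w)) \<in> fst d"
      using w' by (auto simp: F_def e_def T2_def)
  qed
  have Ff: "fst (f y) = F y" if "y \<in> W" for y
    using Fg[of "f y"] gf[OF that] fV that by auto
  have WU: "W \<subseteq> snd c ` (fst c \<inter> \<pi> -` fst d)"
    using fst\<Phi> by (fastforce simp: W_def T1_def e_def)
  note F_smooth = smooth_map_coordinates(2)[OF AP AM \<pi> c d, folded F_def]
  have Fd: "F differentiable (at y)" if "y \<in> W" for y
    using smooth_on_differentiable[OF F_smooth] WU that by blast
  have fd: "(f has_derivative D f y) (at y)" if "y \<in> W" for y
    by (rule has_derivative_D[OF smooth_on_differentiable[OF sf that]])
  have gd: "(g has_derivative D g w) (at w)" if "w \<in> V" for w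
    by (rule has_derivative_D[OF smooth_on_differentiable[OF sg that]])
  let ?x = "snd c p"
  have xW: "?x \<in> W" using p pU pd a(2) fst\<Phi>[OF pU] by (auto simp: W_def T1_def e_def mem_Times_iff)
  \<comment> \<open>The components of z in the trivialization. The base component vanishes because z
    is vertical.\<close>
  define \<zeta> where "\<zeta> = D f ?x z"
  have \<zeta>0: "fst \<zeta> = 0"
  proof -
    have "(F has_derivative (\<lambda>v. fst (D f ?x v))) (at ?x)"
      by (rule has_derivative_transform_within_open[OF has_derivative_fst[OF fd[OF xW]] oW xW Ff])
    then show ?thesis using D_eq z by (fastforce simp: F_def \<zeta>_def)
  qed
  define Z where "Z y = D g (f y) \<zeta>" for y
  have "smooth_on W Z"
    unfolding Z_def by (rule smooth_on_compose[OF fde oW fV sf smooth_on_D[OF sg]])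
  moreover have "Z ?x = z"
  proof -
    have "f ?x \<in> V" using xW fV by blast
    from diff_chain_at[OF fd[OF xW] gd[OF this]]
    have 1: "((\<lambda>y. g (f y)) has_derivative (\<lambda>v. D g (f ?x) (D f ?x v))) (at ?x)" by (simp add: o_def)
    have "((\<lambda>y. g (f y)) has_derivative (\<lambda>v. v)) (at ?x)"
      by (rule has_derivative_transform_within_open[OF has_derivative_ident oW xW]) (simp add: gf)
    from fun_cong[OF has_derivative_unique[OF 1 this], of z] show ?thesis by (simp add: Z_def \<zeta>_def)
  qed
  moreover have "D F y (Z y) = 0" if y: "y \<in> W" for y
  proof -
    have fy: "f y \<in> V" using y fV by blast
    have "(F has_derivative D F y) (at (g (f y)))" using has_derivative_D[OF Fd[OF y]] gf[OF y] by simp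
    from diff_chain_at[OF gd[OF fy] this]
    have 1: "((\<lambda>w. F (g w)) has_derivative (\<lambda>v. D F y (D g (f y) v))) (at (f y))" by (simp add: o_def)
    have "((\<lambda>w. F (g w)) has_derivative (\<lambda>v. fst v)) (at (f y))"
      by (rule has_derivative_transform_within_open[OF has_derivative_fst[OF has_derivative_ident] oV fy])
        (simp add: Fg)
    from fun_cong[OF has_derivative_unique[OF 1 this], of \<zeta>] show ?thesis by (simp add: Z_def \<zeta>0)
  qed
  moreover have "tangent_to AP S c q (Z (snd c q))" if qS: "q \<in> S" and qc: "q \<in> fst c" and qW: "snd c q \<in> W" for q
  proof -
    let ?y = "snd c q"
    have w0: "f ?y \<in> V" using qW fV by blast
    \<comment> \<open>The coordinate line in direction \<zeta>. Its base component is constant, so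
      its image under g remains in one fibre.\<close>
    let ?l = "\<lambda>t::real. f ?y + t *\<^sub>R \<zeta>"
    have "open (?l -` V)" by (intro open_vimage[OF oV] continuous_intros)
    moreover have "0 \<in> ?l -` V" using w0 by simp
    ultimately obtain \<epsilon> where \<epsilon>: "\<epsilon> > 0" "ball 0 \<epsilon> \<subseteq> ?l -` V" using openE by blast
    let ?I = "{-\<epsilon><..<\<epsilon>}"
    have lV: "?l t \<in> V" if "t \<in> ?I" for t
      using \<epsilon>(2) that by (auto simp: subset_iff dist_real_def abs_less_iff)
    have sl: "smooth_on ?I ?l"
      by (rule smooth_on_affine[OF open_greaterThanLessThan bounded_linear_scaleR_left])
    let ?\<gamma> = "\<lambda>t. g (?l t)"
    have s\<gamma>: "smooth_on ?I ?\<gamma>"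
      by (rule smooth_on_compose[OF fde open_greaterThanLessThan _ sl sg]) (use lV in blast)
    let ?s = "\<lambda>t. chart_inv c (?\<gamma> t)"
    have smooth: "smooth_map_on ?I line_atlas AP ?s"
      by (rule smooth_curve_in_chart[OF AP c open_greaterThanLessThan s\<gamma>]) (use lV gV in blast)
    have s0: "?s 0 = q" using gf[OF qW] chart_inv_left[OF cc qc] by simp
    have \<pi>q: "\<pi> q \<in> fst d" using \<pi>g[OF w0] gf[OF qW] chart_inv_left[OF cc qc] by simp
    have "?s t \<in> S" if t: "t \<in> ?I" for t
    proof -
      \<comment> \<open>Equal coordinates F give equal points of the base only inside the domain of
        d, which is why \<open>\<pi>g\<close> was recorded.\<close>
      have "F (?\<gamma> t) = F ?y" using Fg[OF lV[OF t]] Fg[OF w0] gf[OF qW] \<zeta>0 by simp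
      then have "snd d (\<pi> (?s t)) = snd d (\<pi> q)" using chart_inv_left[OF cc qc] by (simp add: F_def)
      then have "\<pi> (?s t) = \<pi> q"
        using chart_inv_left[OF dd \<pi>g[OF lV[OF t]]] chart_inv_left[OF dd \<pi>q] by metis
      then show ?thesis using S qS by simp
    qed
    then have sS: "?s ` ?I \<subseteq> S" by blast
    have l0: "(?l has_derivative (\<lambda>t. t *\<^sub>R \<zeta>)) (at 0)"
      by (auto intro!: derivative_eq_intros)
    have "(g has_derivative D g (f ?y)) (at (?l 0))" using gd[OF w0] by simp
    from diff_chain_at[OF l0 this]
    have "(?\<gamma> has_derivative (\<lambda>t. D g (f ?y) (t *\<^sub>R \<zeta>))) (at 0)" by (simp add: o_def)
    then have "(snd c \<circ> ?s has_derivative (\<lambda>t. D g (f ?y) (t *\<^sub>R \<zeta>))) (at 0)"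
      by (rule has_derivative_transform_within_open[OF _ open_greaterThanLessThan[of "-\<epsilon>" \<epsilon>]])
        (use \<epsilon>(1) chart_inv_right[OF gV[OF lV]] in auto)
    then have "(snd c \<circ> ?s has_vector_derivative Z ?y) (at 0)"
      using linear_scale[OF has_derivative_linear[OF gd[OF w0]]]
      by (simp add: has_vector_derivative_def Z_def)
    then have "vector_derivative (snd c \<circ> ?s) (at 0) = Z ?y" by (rule vector_derivative_at)
    then show ?thesis
      unfolding tangent_to_def using \<epsilon>(1) smooth sS s0 by blast
  qed
  ultimately show ?thesis
    using oW xW WU unfolding F_def[symmetric] by blast
qed

text \<open>Translation of the geometric hypotheses at p into coordinates; c and d are the very
  charts that \<open>laplacian\<close> chooses at p and at \<pi> p.\<close>

theorem laplacian_pullback: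
  fixes AP :: "('p::topological_space, 'e::real_inner) chart set"
    and AM :: "('m::topological_space, 'f::real_inner) chart set"
  assumes AG: "smooth_atlas AG" and AP: "smooth_atlas AP" and AM: "smooth_atlas AM"
    and gP: "riemannian_metric AP gP" and gM: "riemannian_metric AM gM"
    and submersion: "riemannian_submersion AP gP AM gM \<pi>"
    and principal: "principal_bundle G AG AP AM act \<pi>"
    and geodesic: "totally_geodesic AP gP (orbit G act p)"
    and \<phi>: "smooth_fun AM \<phi>"
  shows "laplacian AP gP (\<phi> \<circ> \<pi>) p = laplacian AM gM \<phi> (\<pi> p)"
proof -
  define c where "c = chart_at AP p"
  define d where "d = chart_at AM (\<pi> p)"
  have c: "c \<in> AP" "p \<in> fst c" and d: "d \<in> AM" "\<pi> p \<in> fst d"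
    unfolding c_def d_def using chart_at AP AM by blast+
  note cc = smooth_atlasD(2)[OF AP c(1)] and dd = smooth_atlasD(2)[OF AM d(1)]
  note fdE = smooth_atlasD(1)[OF AP] and fdF = smooth_atlasD(1)[OF AM]
  have \<pi>: "smooth_map AP AM \<pi>" using submersion by (simp add: riemannian_submersion_def)
  define F where "F = snd d \<circ> \<pi> \<circ> chart_inv c"
  define U where "U = snd c ` (fst c \<inter> \<pi> -` fst d)"
  define V where "V = snd d ` fst d"
  define h where "h = local_metric gP c"
  define k where "k = local_metric gM d"
  define u where "u = \<phi> \<circ> chart_inv d"
  let ?x = "snd c p"
  have oU: "open U" and sF: "smooth_on U F"
    unfolding U_def F_def using smooth_map_coordinates[OF AP AM \<pi> c(1) d(1)] by auto
  have h: "metric_on U h"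
    unfolding h_def by (rule riemannian_metric_on[OF AP gP c(1) oU]) (auto simp: U_def)
  have k: "metric_on V k"
    unfolding k_def V_def by (rule riemannian_metric_on[OF AM gM d(1) chart_open(2)[OF dd]]) simp
  have x: "?x \<in> U" using c d by (auto simp: U_def)
  have Fc: "F (snd c q) = snd d (\<pi> q)" if "q \<in> fst c" for q
    using chart_inv_left[OF cc that] by (simp add: F_def)
  have FV: "F ` U \<subseteq> V" using Fc by (auto simp: U_def V_def)
  have su: "smooth_on V u" using \<phi> d(1) by (simp add: smooth_map_on_def line_atlas_def V_def u_def)
  note F1 = smooth_on_differentiable[OF sF]
  have co: "coisometry (h y) (k (F y)) (D F y)" if y: "y \<in> U" for y
  proof -
    obtain q where q: "y = snd c q" "q \<in> fst c" "\<pi> q \<in> fst d" using y by (auto simp: U_def)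
    have T: "tangent_map c d \<pi> q = D F y" by (simp add: fun_eq_iff tangent_map_def F_def q(1))
    have hq: "h y = gP c q" using chart_inv_left[OF cc q(2)] by (simp add: h_def local_metric_def q(1))
    have kq: "k (F y) = gM d (\<pi> q)"
      using Fc[OF q(2)] chart_inv_left[OF dd q(3)] by (simp add: k_def local_metric_def q(1))
    have "horizontal gP c d \<pi> q v \<longleftrightarrow> horizontal_at (h y) (D F y) v" for v
      by (simp add: horizontal_def horizontal_at_def T hq)
    then show ?thesis
      using submersion c(1) d(1) q(2,3) has_derivative_linear[OF has_derivative_D[OF F1[OF y]]]
      unfolding riemannian_submersion_def coisometry_def by (simp add: kq hq T[symmetric])
  qed
  have fib: "q \<in> orbit G act p \<longleftrightarrow> \<pi> q = \<pi> p" for q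
    using principal unfolding principal_bundle_def by metis
  obtain U0 \<Phi> where U0: "\<pi> p \<in> U0" "local_trivialization G AG AP AM act \<pi> U0 \<Phi>"
    using principal unfolding principal_bundle_def by blast
  have vert: "\<exists>Z W. Z differentiable (at ?x) \<and> Z ?x = z \<and> open W \<and> ?x \<in> W \<and>
       W \<subseteq> U \<and> (\<forall>y\<in>W. D F y (Z y) = 0) \<and> D F ?x (covariant_derivative h z Z ?x) = 0"
    if z: "D F ?x z = 0" for z
  proof -
    obtain Z W where Z: "open W" "?x \<in> W" "W \<subseteq> U" "smooth_on W Z" "Z ?x = z"
      "\<forall>y\<in>W. D F y (Z y) = 0"
      "\<forall>q\<in>orbit G act p \<inter> fst c. snd c q \<in> W \<longrightarrow> tangent_to AP (orbit G act p) c q (Z (snd c q))"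
      using vertical_field[OF AG AP AM c(1) d(1) c(2) \<pi> U0(2,1) d(2) z[unfolded F_def] fib]
      unfolding F_def[symmetric] U_def[symmetric] by blast
    have "W \<subseteq> snd c ` fst c" using Z(3) by (auto simp: U_def)
    moreover have "p \<in> orbit G act p \<inter> fst c" using fib c(2) by simp
    \<comment> \<open>Total geodesy is applied with both fields equal to Z, so that the direction at
      p is z.\<close>
    ultimately have "tangent_to AP (orbit G act p) c p (covariant_derivative h z Z ?x)"
      using geodesic c(1) Z(1,2,4,5,7) unfolding totally_geodesic_def h_def by blast
    then have "D F ?x (covariant_derivative h z Z ?x) = 0"
      unfolding F_def
      by (rule tangent_to_fibre[OF AP c]) (use fib F1[OF x] in \<open>simp_all add: F_def\<close>)
    then show ?thesis using Z smooth_on_differentiable[OF Z(4,2)] by blast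
  qed
  have main: "divergence h (gradient h (u \<circ> F)) ?x = divergence k (gradient k u) (F ?x)"
  proof (rule divergence_gradient_submersion[OF fdE fdF h k x FV F1 _ _ co vert])
    show "(\<lambda>y. D F y w) differentiable (at y)" if "y \<in> U" for y w
      by (rule smooth_on_differentiable[OF smooth_on_D[OF sF] that])
    show "D (\<lambda>y. D F y w) ?x v = D (\<lambda>y. D F y v) ?x w" for v w
      by (rule second_derivative_symmetric[OF oU x smooth_on_SucD[OF sF]])
    show "u differentiable (at y)" if "y \<in> V" for y
      by (rule smooth_on_differentiable[OF su that])
    show "(\<lambda>y. D u y w) differentiable (at y)" if "y \<in> V" for y w
      by (rule smooth_on_differentiable[OF smooth_on_D[OF su] that])
  qed
  have suF: "smooth_on U (u \<circ> F)"
    using smooth_on_compose[OF fdF oU FV sF su] by (simp add: o_def)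
  have "(u \<circ> F) y = (\<phi> \<circ> \<pi> \<circ> chart_inv c) y" if "y \<in> U" for y
    using that Fc chart_inv_left[OF cc] chart_inv_left[OF dd] by (auto simp: U_def u_def)
  from divergence_gradient_cong[OF fdE h x suF this]
  have "divergence h (gradient h (\<phi> \<circ> \<pi> \<circ> chart_inv c)) ?x = divergence h (gradient h (u \<circ> F)) ?x"
    by (rule sym)
  with main show ?thesis
    using Fc[OF c(2)]
    by (simp add: laplacian_def Let_def c_def[symmetric] d_def[symmetric] h_def k_def u_def)
qed

section \<open>Exchange of the two bases and transfer of invariant functions\<close>

lemma star_diagram_commute:
  assumes "star_diagram G AG AP AM AM' bul star \<pi> \<pi>'"
  shows "star_diagram G AG AP AM' AM star bul \<pi>' \<pi>"
  using assms unfolding star_diagram_def by auto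

text \<open>\<open>descended\<close> uses a chosen preimage. Any other preimage differs from it by
  the \<bullet>-action, which commutes with the \<star>-action and is invisible to \<pi>.\<close>

lemma descended_apply:
  assumes carrier: "carrier G = UNIV" and comm: "\<And>a b p. bul a (star b p) = star b (bul a p)"
    and \<pi>: "principal_bundle G AG AP AM bul \<pi>"
  shows "descended star \<pi> b (\<pi> p) = \<pi> (star b p)"
proof -
  have eq: "\<pi> q = \<pi> r \<longleftrightarrow> (\<exists>a. r = bul a q)" for q r
    using \<pi> carrier unfolding principal_bundle_def orbit_def by auto
  have "\<pi> p = \<pi> (inv_into UNIV \<pi> (\<pi> p))" by (simp add: f_inv_into_f)
  then obtain a where "inv_into UNIV \<pi> (\<pi> p) = bul a p" using eq by blast
  then have "descended star \<pi> b (\<pi> p) = \<pi> (bul a (star b p))" by (simp add: descended_def comm)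
  moreover have "\<pi> (star b p) = \<pi> (bul a (star b p))" using eq by blast
  ultimately show ?thesis by simp
qed

text \<open>Invariance makes \<open>\<phi> \<circ> \<pi>\<close> constant on the fibres of \<pi>',
  so it descends; local sections of \<pi>' give smoothness and surjectivity of \<pi>' gives
  uniqueness.\<close>

lemma invariant_function_transfer:
  assumes diagram: "star_diagram G AG AP AM AM' bul star \<pi> \<pi>'"
    and \<phi>: "\<phi> \<in> invariant_functions AM (descended star \<pi>)"
  shows "\<exists>!\<phi>'. \<phi>' \<in> invariant_functions AM' (descended bul \<pi>') \<and> \<phi> \<circ> \<pi> = \<phi>' \<circ> \<pi>'"
proof -
  have carrier: "carrier G = UNIV" and AG: "smooth_atlas AG" and AP: "smooth_atlas AP"
    and AM: "smooth_atlas AM" and AM': "smooth_atlas AM'"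
    and comm: "\<And>a b p. bul a (star b p) = star b (bul a p)"
    and \<pi>: "principal_bundle G AG AP AM bul \<pi>" and \<pi>': "principal_bundle G AG AP AM' star \<pi>'"
    using diagram unfolding star_diagram_def compact_lie_group_def by blast+
  have s\<phi>: "smooth_fun AM \<phi>" and inv\<phi>: "\<And>a x. \<phi> (descended star \<pi> a x) = \<phi> x"
    using \<phi> by (auto simp: invariant_functions_def)
  have eq': "\<pi>' q = \<pi>' r \<longleftrightarrow> (\<exists>a. r = star a q)" for q r
    using \<pi>' carrier unfolding principal_bundle_def orbit_def by auto
  have eq: "\<pi> q = \<pi> (bul a q)" for q a
    using \<pi> carrier unfolding principal_bundle_def orbit_def by blast
  have surj': "surj \<pi>'" using \<pi>' by (simp add: principal_bundle_def)
  have desc: "descended star \<pi> b (\<pi> p) = \<pi> (star b p)" for b p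
    by (rule descended_apply[where bul = bul, OF carrier comm \<pi>])
  have fib: "\<phi> (\<pi> q) = \<phi> (\<pi> r)" if "\<pi>' q = \<pi>' r" for q r
    using that eq'[of q r] inv\<phi> desc by metis
  define \<phi>' where "\<phi>' y = \<phi> (\<pi> (inv_into UNIV \<pi>' y))" for y
  have \<phi>'\<pi>': "\<phi>' (\<pi>' p) = \<phi> (\<pi> p)" for p
    unfolding \<phi>'_def by (rule fib) (simp add: f_inv_into_f)
  have line: "open (fst e)" if "e \<in> line_atlas" for e using that by (simp add: line_atlas_def)
  note chP = smooth_atlasD(2)[OF AP] and chM' = smooth_atlasD(2)[OF AM']
  have \<phi>\<pi>: "smooth_fun AP (\<lambda>p. \<phi> (\<pi> p))"
    by (rule smooth_map_on_compose[OF chP AM line open_UNIV open_UNIV _ _ s\<phi>])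
      (use \<pi> in \<open>auto simp: principal_bundle_def\<close>)
  have "smooth_fun AM' \<phi>'"
  proof (rule smooth_map_local[OF chM' line])
    fix y
    obtain U \<Phi> where U: "y \<in> U" "local_trivialization G AG AP AM' star \<pi>' U \<Phi>"
      using \<pi>' unfolding principal_bundle_def by blast
    have oU: "open U" using U(2) by (simp add: local_trivialization_def)
    \<comment> \<open>A local section of \<pi>', along which \<phi>' is \<phi> o \<pi> o s, a
      composite of smooth maps.\<close>
    let ?s = "\<lambda>y. inv_into (\<pi>' -` U) \<Phi> (y, \<one>\<^bsub>G\<^esub>)"
    have pulled: "smooth_map_on U AM' line_atlas (\<lambda>y. \<phi> (\<pi> (?s y)))"
      by (rule smooth_map_on_compose[OF chM' AP line oU open_UNIV _ smooth_section[OF AM' AG AP U(2)] \<phi>\<pi>])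
        auto
    have "smooth_map_on U AM' line_atlas \<phi>'"
    proof (rule smooth_map_on_cong[OF chM' line oU pulled])
      fix y assume y: "y \<in> U"
      have bij: "bij_betw \<Phi> (\<pi>' -` U) (U \<times> UNIV)"
        and f\<Phi>: "\<And>q. \<pi>' q \<in> U \<Longrightarrow> fst (\<Phi> q) = \<pi>' q"
        using U(2) by (auto simp: local_trivialization_def)
      have "(y, \<one>\<^bsub>G\<^esub>) \<in> \<Phi> ` (\<pi>' -` U)" using bij y by (simp add: bij_betw_def)
      then have "\<Phi> (?s y) = (y, \<one>\<^bsub>G\<^esub>)" "?s y \<in> \<pi>' -` U"
        by (auto intro: f_inv_into_f inv_into_into simp del: vimage_eq)
      then have "\<pi>' (?s y) = y" using f\<Phi>[of "?s y"] by simp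
      then show "\<phi> (\<pi> (?s y)) = \<phi>' y" using \<phi>'\<pi>'[of "?s y"] by simp
    qed
    then show "\<exists>U. open U \<and> y \<in> U \<and> smooth_map_on U AM' line_atlas \<phi>'" using oU U(1) by blast
  qed
  \<comment> \<open>\<open>descended\<close> and \<phi>' pick the same preimage of y under \<pi>',
    so what remains is that \<pi> is unchanged by the \<bullet>-action.\<close>
  moreover have "\<phi>' (descended bul \<pi>' a y) = \<phi>' y" for a y
    using \<phi>'\<pi>' eq by (simp add: descended_def) (simp add: \<phi>'_def)
  ultimately have "\<phi>' \<in> invariant_functions AM' (descended bul \<pi>')"
    by (simp add: invariant_functions_def)
  moreover have "\<phi> \<circ> \<pi> = \<phi>' \<circ> \<pi>'" using \<phi>'\<pi>' by (simp add: fun_eq_iff)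
  moreover have "\<psi> = \<phi>'" if "\<phi> \<circ> \<pi> = \<psi> \<circ> \<pi>'" for \<psi>
  proof
    fix y
    obtain p where "y = \<pi>' p" using surj' by (metis surjD)
    then show "\<psi> y = \<phi>' y" using fun_cong[OF that, of p] \<phi>'\<pi>'[of p] by simp
  qed
  ultimately show ?thesis by blast
qed

text \<open>Surjectivity of \<pi>' carries the equation to every point of M', and surjectivity of
  \<pi> carries a nonzero value across.\<close>

lemma eigenfunction_transfer:
  assumes diagram: "star_diagram G AG AP AM AM' bul star \<pi> \<pi>'"
    and metrics: "riemannian_metric AP gP" "riemannian_metric AM gM" "riemannian_metric AM' gM'"
    and submersion: "riemannian_submersion AP gP AM gM \<pi>" "riemannian_submersion AP gP AM' gM' \<pi>'"
    and geodesic: "\<And>p. totally_geodesic AP gP (orbit G bul p)"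
      "\<And>p. totally_geodesic AP gP (orbit G star p)"
    and \<phi>: "eigenfunction AM gM l \<phi>" and \<phi>': "smooth_fun AM' \<phi>'" and eq: "\<phi> \<circ> \<pi> = \<phi>' \<circ> \<pi>'"
  shows "eigenfunction AM' gM' l \<phi>'"
proof -
  have AG: "smooth_atlas AG" and AP: "smooth_atlas AP"
    and AM: "smooth_atlas AM" and AM': "smooth_atlas AM'"
    and \<pi>: "principal_bundle G AG AP AM bul \<pi>" and \<pi>': "principal_bundle G AG AP AM' star \<pi>'"
    using diagram unfolding star_diagram_def compact_lie_group_def by blast+
  have surj: "surj \<pi>" "surj \<pi>'" using \<pi> \<pi>' by (auto simp: principal_bundle_def)
  have eqp: "\<phi> (\<pi> p) = \<phi>' (\<pi>' p)" for p using fun_cong[OF eq, of p] by simp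
  have s\<phi>: "smooth_fun AM \<phi>" using \<phi> by (simp add: eigenfunction_def)
  have lap: "laplacian AM' gM' \<phi>' (\<pi>' p) = laplacian AM gM \<phi> (\<pi> p)" for p
    using laplacian_pullback[OF AG AP AM metrics(1,2) submersion(1) \<pi> geodesic(1) s\<phi>, of p]
      laplacian_pullback[OF AG AP AM' metrics(1,3) submersion(2) \<pi>' geodesic(2) \<phi>', of p]
    by (simp add: eq)
  have "- laplacian AM' gM' \<phi>' y = l * \<phi>' y" for y
  proof -
    obtain p where "y = \<pi>' p" using surj(2) by (metis surjD)
    then show ?thesis using \<phi> lap[of p] eqp[of p] by (simp add: eigenfunction_def)
  qed
  moreover have "\<exists>y. \<phi>' y \<noteq> 0"
  proof -
    obtain x where x: "\<phi> x \<noteq> 0" using \<phi> by (auto simp: eigenfunction_def)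
    obtain p where "x = \<pi> p" using surj(1) by (metis surjD)
    then show ?thesis using x eqp[of p] by auto
  qed
  ultimately show ?thesis using \<phi>' by (simp add: eigenfunction_def)
qed

text \<open>The correspondence is the relation
  \<open>\<phi> \<circ> \<pi> = \<phi>' \<circ> \<pi>'\<close>. Unique existence of the partner is
  asserted along with the equality of eigenvalues, so that the claim about all partners is not
  vacuous.\<close>

theorem proposition1:
  fixes G :: "'g::{t2_space, second_countable_topology} monoid"
    and AG :: "('g, 'l::real_inner) chart set"
    and AP :: "('p::{t2_space, second_countable_topology}, 'e::real_inner) chart set"
    and AM :: "('m::{t2_space, second_countable_topology}, 'f::real_inner) chart set"
    and AM' :: "('n::{t2_space, second_countable_topology}, 'h::real_inner) chart set"
    and bul star :: "'g \<Rightarrow> 'p \<Rightarrow> 'p"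
    and \<pi> :: "'p \<Rightarrow> 'm" and \<pi>' :: "'p \<Rightarrow> 'n"
    and gP :: "('p, 'e) metric" and gM :: "('m, 'f) metric" and gM' :: "('n, 'h) metric"
  assumes diagram: "star_diagram G AG AP AM AM' bul star \<pi> \<pi>'"
    and closed: "compact (UNIV :: 'p set)" "compact (UNIV :: 'm set)" "compact (UNIV :: 'n set)"
    and connected: "connected (UNIV :: 'p set)" "connected (UNIV :: 'm set)"
      "connected (UNIV :: 'n set)"
    and metrics: "riemannian_metric AP gP" "riemannian_metric AM gM" "riemannian_metric AM' gM'"
    and invariant: "\<And>a b. preserves_metric AP gP (\<lambda>p. bul a (star b p))"
    and submersion: "riemannian_submersion AP gP AM gM \<pi>"
      "riemannian_submersion AP gP AM' gM' \<pi>'"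
    and isometric: "isometric_orbit_spaces G AM gM (descended star \<pi>) AM' gM' (descended bul \<pi>')"
    and geodesic: "\<And>p. totally_geodesic AP gP (orbit G bul p)"
      "\<And>p. totally_geodesic AP gP (orbit G star p)"
  shows "(\<forall>\<phi>\<in>invariant_functions AM (descended star \<pi>). \<forall>l. eigenfunction AM gM l \<phi> \<longrightarrow>
           (\<exists>!\<phi>'. \<phi>' \<in> invariant_functions AM' (descended bul \<pi>') \<and> \<phi> \<circ> \<pi> = \<phi>' \<circ> \<pi>') \<and>
           (\<forall>\<phi>'\<in>invariant_functions AM' (descended bul \<pi>'). \<phi> \<circ> \<pi> = \<phi>' \<circ> \<pi>' \<longrightarrow>
              eigenfunction AM' gM' l \<phi>')) \<and>
         (\<forall>\<phi>'\<in>invariant_functions AM' (descended bul \<pi>'). \<forall>l. eigenfunction AM' gM' l \<phi>' \<longrightarrow>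
           (\<exists>!\<phi>. \<phi> \<in> invariant_functions AM (descended star \<pi>) \<and> \<phi> \<circ> \<pi> = \<phi>' \<circ> \<pi>') \<and>
           (\<forall>\<phi>\<in>invariant_functions AM (descended star \<pi>). \<phi> \<circ> \<pi> = \<phi>' \<circ> \<pi>' \<longrightarrow>
              eigenfunction AM gM l \<phi>))"
proof (intro conjI ballI allI impI)
  fix \<phi> l assume \<phi>: "\<phi> \<in> invariant_functions AM (descended star \<pi>)" and "eigenfunction AM gM l \<phi>"
  then show "eigenfunction AM' gM' l \<phi>'"
    if "\<phi>' \<in> invariant_functions AM' (descended bul \<pi>')" "\<phi> \<circ> \<pi> = \<phi>' \<circ> \<pi>'" for \<phi>'
    using that eigenfunction_transfer[OF diagram metrics submersion geodesic]
    by (simp add: invariant_functions_def)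
  show "\<exists>!\<phi>'. \<phi>' \<in> invariant_functions AM' (descended bul \<pi>') \<and> \<phi> \<circ> \<pi> = \<phi>' \<circ> \<pi>'"
    by (rule invariant_function_transfer[OF diagram \<phi>])
next
  \<comment> \<open>The converse half is the same argument for the exchanged diagram, with metrics,
    submersions and geodesic orbits exchanged accordingly.\<close>
  note diagram' = star_diagram_commute[OF diagram]
  fix \<phi>' l assume \<phi>': "\<phi>' \<in> invariant_functions AM' (descended bul \<pi>')" and "eigenfunction AM' gM' l \<phi>'"
  then show "eigenfunction AM gM l \<phi>"
    if "\<phi> \<in> invariant_functions AM (descended star \<pi>)" "\<phi> \<circ> \<pi> = \<phi>' \<circ> \<pi>'" for \<phi>
    using that eigenfunction_transfer[OF diagram' metrics(1,3,2) submersion(2,1) geodesic(2,1), of l \<phi>' \<phi>]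
    by (simp add: invariant_functions_def)
  show "\<exists>!\<phi>. \<phi> \<in> invariant_functions AM (descended star \<pi>) \<and> \<phi> \<circ> \<pi> = \<phi>' \<circ> \<pi>'"
    using invariant_function_transfer[OF diagram' \<phi>'] by (simp add: eq_commute)
qed

end
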